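(* Let $(\mathbf{H},\varphi)$ be a linearized combinatorial Hopf monoid, let $N$ be a finite set, $\mathbf{h}\in\mathbf{H}[N]$, and $\mathfrak{G}\subseteq\mathrm{Aut}(\mathbf{h})$. Then: \begin{enumerate} \item $\Psi^O_{\mathbf{H},\varphi}(\mathbf{h},\mathfrak{G},\mathbf{x})=\frac{1}{|\mathfrak{G}|}\sum_{\mathfrak{g}\in\mathfrak{G}}\Psi_{\mathbf{H},\varphi}(\mathbf{h},\mathfrak{G},\mathbf{x};\mathfrak{g})$; \item for every integer composition $\alpha\models|N|$, the coefficient of $M_\alpha$ in $\Psi^O_{\mathbf{H},\varphi}(\mathbf{h},\mathfrak{G},\mathbf{x})$ equals $|\mathcal{C}_{\mathbf{h},\alpha}/\mathfrak{G}|$, the number of $\mathfrak{G}$-orbits on $\mathcal{C}_{\mathbf{h},\alpha}$; \item $\Psi^O_{\mathbf{H},\varphi}(\mathbf{h},\mathfrak{G},x)=\mathrm{ps}\big(\Psi^O_{\mathbf{H},\varphi}(\mathbf{h},\mathfrak{G},\mathbf{x})\big)=\frac{1}{|\mathfrak{G}|}\sum_{\mathfrak{g}\in\mathfrak{G}}\Psi_{\mathbf{H},\varphi}(\mathbf{h},\mathfrak{G},x;\mathfrak{g})$. \end{enumerate}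
   Context: $\mathbb{N}=\{0,1,2,\dots\}$, $[x]=\{1,\dots,x\}$, $\mathbf{x}=x_1,x_2,\dots$ commuting indeterminates. A set species $\mathbf{H}$ assigns to each finite set $N$ a finite set $\mathbf{H}[N]$ and to each bijection $\sigma:M\to N$ a bijection $\mathbf{H}[\sigma]$, functorially. A linearized Hopf monoid is a set species with $|\mathbf{H}[\emptyset]|=1$ together with, for disjoint finite $M,N$, maps $\mu_{M,N}:\mathbf{H}[M]\times\mathbf{H}[N]\to\mathbf{H}[M\sqcup N]$, $(x,y)\mapsto x\cdot y$, and $\Delta_{M,N}:\mathbf{H}[M\sqcup N]\to(\mathbf{H}[M]\times\mathbf{H}[N])\sqcup\{0\}$, writing $\Delta_{M,N}(\mathbf{h})=(\mathbf{h}|_M,\mathbf{h}/M)$ when nonzero, whose linear extensions make the linearization a connected Hopf monoid in linear species. A linearized character is a family $\varphi_N:\mathbf{H}[N]\to\{0,1\}$, natural in bijections, with $\varphi(x\cdot y)=\varphi(x)\varphi(y)$; $(\mathbf{H},\varphi)$ is then a linearized combinatorial Hopf monoid. For a set composition $C=C_1|\cdots|C_k\models N$ (disjoint nonempty blocks with union $N$, type $\alpha(C)=(|C_1|,\dots,|C_k|)$), $\Delta_C(\mathbf{h})$ is defined iteratively: $\mathbf{h}$ if $k=1$; otherwise $0$ if $\Delta_{C_1,N\setminus C_1}(\mathbf{h})=0$, else $(\mathbf{h}|_{C_1},\Delta_{C_2|\cdots|C_k}(\mathbf{h}/C_1))$; $\varphi_C(\mathbf{h})=\prod\varphi(\mathbf{h}_i)$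 if $\Delta_C(\mathbf{h})=(\mathbf{h}_1,\dots,\mathbf{h}_k)$, else $0$. $\mathcal{C}_{\mathbf{h},\alpha}$ is the set of $C\models N$ of type $\alpha$ with $\varphi_C(\mathbf{h})=1$. For $f:N\to\mathbb{N}$ with values $i_1<\dots<i_k$, $C(f)=f^{-1}(i_1)|\cdots|f^{-1}(i_k)$; $f$ is a $\varphi$-proper coloring iff $\varphi_{C(f)}(\mathbf{h})=1$; $F_\varphi(\mathbf{h})$ is their set. $\mathfrak{S}_N$ acts on $\mathbf{H}[N]$ by $\mathfrak{g}\cdot\mathbf{h}=\mathbf{H}[\mathfrak{g}](\mathbf{h})$, $\mathrm{Aut}(\mathbf{h})$ is the stabilizer; $\mathfrak{g}f=f\circ\mathfrak{g}^{-1}$ on colorings and $\mathfrak{g}C=\mathfrak{g}(C_1)|\cdots|\mathfrak{g}(C_k)$ on set compositions. $\Psi_{\mathbf{H},\varphi}(\mathbf{h},\mathfrak{G},\mathbf{x};\mathfrak{g})=\sum_{f\in F_\varphi(\mathbf{h}),\mathfrak{g}f=f}\prod_{v\in N}x_{f(v)}$; $\Psi_{\mathbf{H},\varphi}(\mathbf{h},\mathfrak{G},x;\mathfrak{g})$ is the number of $f\in F_\varphi(\mathbf{h})$ with $\mathfrak{g}f=f$ and $f(N)\subseteq[x]$. The orbital $\varphi$-chromatic quasisymmetric function is $\Psi^O_{\mathbf{H},\varphi}(\mathbf{h},\mathfrak{G},\mathbf{x})=\sum_{O}\mathbf{x}^{O}$, the sum over $\mathfrak{G}$-orbits $O$ of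 $F_\varphi(\mathbf{h})$, where $\mathbf{x}^O=\prod_{v\in N}x_{f(v)}$ for any $f\in O$; the orbital $\varphi$-chromatic polynomial $\Psi^O_{\mathbf{H},\varphi}(\mathbf{h},\mathfrak{G},x)$ is the number of $\mathfrak{G}$-orbits of $\varphi$-proper colorings $f$ with $f(N)\subseteq[x]$. $M_\alpha=\sum_{i_1<\cdots<i_k}\prod_jx_{i_j}^{\alpha_j}$. The principal specialization $\mathrm{ps}(F)(x)$ of a quasisymmetric function $F$ is the polynomial obtained by setting $x_i=1$ for $i\le x$ and $x_i=0$ for $i>x$.
   Formalization: Colorings take values in the positive integers {1,2,…} rather than in ℕ={0,1,2,…}: the indeterminates are x_1,x_2,…, so x_0 is undefined, and item 3 would fail if a color 0 were allowed. *)

theory Defs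
  imports
    "HOL-Algebra.Group_Action"
    "HOL-Library.Disjoint_Sets"
    "HOL-Library.Infinite_Typeclass"
    "HOL-Library.Poly_Mapping"
    "HOL-Computational_Algebra.Polynomial"
begin

section \<open>Free vector spaces\<close>

text \<open>
  The vector space with basis \<open>X\<close> over a field \<open>'k\<close> consists of the finitely supported
  functions \<open>'x \<Rightarrow>\<^sub>0 'k\<close> whose keys lie in \<open>X\<close>. The tensor product of the spaces
  with bases \<open>X\<close> and \<open>Y\<close> is the space with basis \<open>X \<times> Y\<close>.
\<close>

definition free_space :: "'x set \<Rightarrow> ('x \<Rightarrow>\<^sub>0 'k::field) set" where
  "free_space X = {v. Poly_Mapping.keys v \<subseteq> X}"

definition scale :: "'k::field \<Rightarrow> ('x \<Rightarrow>\<^sub>0 'k) \<Rightarrow> ('x \<Rightarrow>\<^sub>0 'k)" where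
  "scale c v = Poly_Mapping.map ((*) c) v"

definition linear_between ::
    "'x set \<Rightarrow> 'y set \<Rightarrow> (('x \<Rightarrow>\<^sub>0 'k::field) \<Rightarrow> ('y \<Rightarrow>\<^sub>0 'k)) \<Rightarrow> bool" where
  "linear_between X Y T \<longleftrightarrow>
     (\<forall>v\<in>free_space X. T v \<in> free_space Y) \<and>
     (\<forall>v\<in>free_space X. \<forall>w\<in>free_space X. T (v + w) = T v + T w) \<and>
     (\<forall>c. \<forall>v\<in>free_space X. T (scale c v) = scale c (T v))"

definition linear_ext :: "('x \<Rightarrow> ('y \<Rightarrow>\<^sub>0 'k::field)) \<Rightarrow> ('x \<Rightarrow>\<^sub>0 'k) \<Rightarrow> ('y \<Rightarrow>\<^sub>0 'k)" where
  "linear_ext f v = (\<Sum>x\<in>Poly_Mapping.keys v. scale (Poly_Mapping.lookup v x) (f x))"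

text \<open>Linear extension of a map \<open>X \<rightarrow> Y \<squnion> {0}\<close>, where \<open>None\<close> encodes \<open>0\<close>.\<close>

definition lin0 :: "('x \<Rightarrow> 'y option) \<Rightarrow> ('x \<Rightarrow>\<^sub>0 'k::field) \<Rightarrow> ('y \<Rightarrow>\<^sub>0 'k)" where
  "lin0 f = linear_ext (\<lambda>x. case f x of None \<Rightarrow> 0 | Some y \<Rightarrow> Poly_Mapping.single y 1)"

definition lin :: "('x \<Rightarrow> 'y) \<Rightarrow> ('x \<Rightarrow>\<^sub>0 'k::field) \<Rightarrow> ('y \<Rightarrow>\<^sub>0 'k)" where
  "lin f = lin0 (\<lambda>x. Some (f x))"

definition tensor :: "('x \<Rightarrow>\<^sub>0 'k::field) \<Rightarrow> ('y \<Rightarrow>\<^sub>0 'k) \<Rightarrow> ('x \<times> 'y \<Rightarrow>\<^sub>0 'k)" where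
  "tensor v w = (\<Sum>x\<in>Poly_Mapping.keys v. \<Sum>y\<in>Poly_Mapping.keys w.
     Poly_Mapping.single (x, y) (Poly_Mapping.lookup v x * Poly_Mapping.lookup w y))"

definition tensor_map ::
    "(('x \<Rightarrow>\<^sub>0 'k::field) \<Rightarrow> ('x2 \<Rightarrow>\<^sub>0 'k)) \<Rightarrow> (('y \<Rightarrow>\<^sub>0 'k) \<Rightarrow> ('y2 \<Rightarrow>\<^sub>0 'k)) \<Rightarrow>
     ('x \<times> 'y \<Rightarrow>\<^sub>0 'k) \<Rightarrow> ('x2 \<times> 'y2 \<Rightarrow>\<^sub>0 'k)" where
  "tensor_map S T =
     linear_ext (\<lambda>(x, y). tensor (S (Poly_Mapping.single x 1)) (T (Poly_Mapping.single y 1)))"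

text \<open>For a functional \<open>\<epsilon>\<close>: the maps \<open>\<epsilon> \<otimes> id\<close> and \<open>id \<otimes> \<epsilon>\<close>, followed by the
  identification of \<open>k \<otimes> V\<close> and \<open>V \<otimes> k\<close> with \<open>V\<close>.\<close>

definition contract_left ::
    "(('x \<Rightarrow>\<^sub>0 'k::field) \<Rightarrow> 'k) \<Rightarrow> ('x \<times> 'y \<Rightarrow>\<^sub>0 'k) \<Rightarrow> ('y \<Rightarrow>\<^sub>0 'k)" where
  "contract_left \<epsilon> =
     linear_ext (\<lambda>(x, y). Poly_Mapping.single y (\<epsilon> (Poly_Mapping.single x 1)))"

definition contract_right ::
    "(('y \<Rightarrow>\<^sub>0 'k::field) \<Rightarrow> 'k) \<Rightarrow> ('x \<times> 'y \<Rightarrow>\<^sub>0 'k) \<Rightarrow> ('x \<Rightarrow>\<^sub>0 'k)" where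
  "contract_right \<epsilon> =
     linear_ext (\<lambda>(x, y). Poly_Mapping.single x (\<epsilon> (Poly_Mapping.single y 1)))"

definition tensor_assoc :: "(('x \<times> 'y) \<times> 'z \<Rightarrow>\<^sub>0 'k::field) \<Rightarrow> ('x \<times> 'y \<times> 'z \<Rightarrow>\<^sub>0 'k)" where
  "tensor_assoc = lin (\<lambda>((x, y), z). (x, y, z))"

definition tensor_interchange ::
    "(('a \<times> 'b) \<times> ('c \<times> 'd) \<Rightarrow>\<^sub>0 'k::field) \<Rightarrow> (('a \<times> 'c) \<times> ('b \<times> 'd) \<Rightarrow>\<^sub>0 'k)" where
  "tensor_interchange = lin (\<lambda>((a, b), (c, d)). ((a, c), (b, d)))"


section \<open>Species\<close>

text \<open>
  Species are indexed by the finite subsets of an infinite type \<open>'a\<close> of labels, so that every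
  finite cardinality occurs. A bijection \<open>\<sigma> : M \<rightarrow> N\<close> is a function that is
  \<open>undefined\<close> outside \<open>M\<close>; then \<open>\<sigma>\<close> is determined by its values on \<open>M\<close>,
  and \<open>Bij N = bijections N N\<close>. The sets \<open>H M\<close> and \<open>H N\<close> may overlap for
  \<open>M \<noteq> N\<close>, so all operations carry their index sets.
\<close>

definition bijections :: "'a set \<Rightarrow> 'a set \<Rightarrow> ('a \<Rightarrow> 'a) set" where
  "bijections M N = {\<sigma> \<in> extensional M. bij_betw \<sigma> M N}"

locale set_species =
  fixes H :: "'a::infinite set \<Rightarrow> 'h set"
    and Hmap :: "'a set \<Rightarrow> ('a \<Rightarrow> 'a) \<Rightarrow> 'h \<Rightarrow> 'h"
  assumes finite_structures: "finite N \<Longrightarrow> finite (H N)"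
    and Hmap_bij: "finite M \<Longrightarrow> \<sigma> \<in> bijections M N \<Longrightarrow> bij_betw (Hmap M \<sigma>) (H M) (H N)"
    and Hmap_id: "finite N \<Longrightarrow> h \<in> H N \<Longrightarrow> Hmap N (\<lambda>v\<in>N. v) h = h"
    and Hmap_compose: "finite L \<Longrightarrow> \<sigma> \<in> bijections L M \<Longrightarrow> \<tau> \<in> bijections M N \<Longrightarrow>
      h \<in> H L \<Longrightarrow> Hmap L (compose L \<tau> \<sigma>) h = Hmap M \<tau> (Hmap L \<sigma> h)"

text \<open>
  A linear species is given with a basis \<open>B N\<close> of each of its spaces; the structure maps are
  arbitrary linear maps.
\<close>

locale linear_species =
  fixes B :: "'a::infinite set \<Rightarrow> 'h set"
    and P :: "'a set \<Rightarrow> ('a \<Rightarrow> 'a) \<Rightarrow> ('h \<Rightarrow>\<^sub>0 'k::field) \<Rightarrow> ('h \<Rightarrow>\<^sub>0 'k)"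
  assumes P_linear: "finite M \<Longrightarrow> \<sigma> \<in> bijections M N \<Longrightarrow> linear_between (B M) (B N) (P M \<sigma>)"
    and P_id: "finite N \<Longrightarrow> v \<in> free_space (B N) \<Longrightarrow> P N (\<lambda>x\<in>N. x) v = v"
    and P_compose: "finite L \<Longrightarrow> \<sigma> \<in> bijections L M \<Longrightarrow> \<tau> \<in> bijections M N \<Longrightarrow>
      v \<in> free_space (B L) \<Longrightarrow> P L (compose L \<tau> \<sigma>) v = P M \<tau> (P L \<sigma> v)"

text \<open>
  A connected bimonoid in linear species; connectedness makes the antipode exist automatically,
  so this is the same as a connected Hopf monoid. In \<open>compatibility\<close> the two decompositions
  of the index set are \<open>(A \<union> B') \<union> (C \<union> D)\<close> and \<open>(A \<union> C) \<union> (B' \<union> D)\<close>.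
\<close>

locale connected_hopf_monoid = linear_species B P
  for B :: "'a::infinite set \<Rightarrow> 'h set"
    and P :: "'a set \<Rightarrow> ('a \<Rightarrow> 'a) \<Rightarrow> ('h \<Rightarrow>\<^sub>0 'k::field) \<Rightarrow> ('h \<Rightarrow>\<^sub>0 'k)" +
  fixes \<mu> :: "'a set \<Rightarrow> 'a set \<Rightarrow> ('h \<times> 'h \<Rightarrow>\<^sub>0 'k) \<Rightarrow> ('h \<Rightarrow>\<^sub>0 'k)"
    and \<Delta> :: "'a set \<Rightarrow> 'a set \<Rightarrow> ('h \<Rightarrow>\<^sub>0 'k) \<Rightarrow> ('h \<times> 'h \<Rightarrow>\<^sub>0 'k)"
    and \<iota> :: "'h \<Rightarrow>\<^sub>0 'k"
    and \<epsilon> :: "('h \<Rightarrow>\<^sub>0 'k) \<Rightarrow> 'k"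
  assumes connected: "card (B {}) = 1"
    and \<mu>_linear: "finite M \<Longrightarrow> finite N \<Longrightarrow> M \<inter> N = {} \<Longrightarrow>
      linear_between (B M \<times> B N) (B (M \<union> N)) (\<mu> M N)"
    and \<Delta>_linear: "finite M \<Longrightarrow> finite N \<Longrightarrow> M \<inter> N = {} \<Longrightarrow>
      linear_between (B (M \<union> N)) (B M \<times> B N) (\<Delta> M N)"
    and \<iota>_closed: "\<iota> \<in> free_space (B {})"
    and \<epsilon>_add: "v \<in> free_space (B {}) \<Longrightarrow> w \<in> free_space (B {}) \<Longrightarrow> \<epsilon> (v + w) = \<epsilon> v + \<epsilon> w"
    and \<epsilon>_scale: "v \<in> free_space (B {}) \<Longrightarrow> \<epsilon> (scale c v) = c * \<epsilon> v"
    and \<mu>_natural: "finite M \<Longrightarrow> finite N \<Longrightarrow> M \<inter> N = {} \<Longrightarrow> \<sigma> \<in> bijections (M \<union> N) L \<Longrightarrow>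
      u \<in> free_space (B M \<times> B N) \<Longrightarrow>
      P (M \<union> N) \<sigma> (\<mu> M N u) =
      \<mu> (\<sigma> ` M) (\<sigma> ` N) (tensor_map (P M (restrict \<sigma> M)) (P N (restrict \<sigma> N)) u)"
    and \<Delta>_natural: "finite M \<Longrightarrow> finite N \<Longrightarrow> M \<inter> N = {} \<Longrightarrow> \<sigma> \<in> bijections (M \<union> N) L \<Longrightarrow>
      v \<in> free_space (B (M \<union> N)) \<Longrightarrow>
      \<Delta> (\<sigma> ` M) (\<sigma> ` N) (P (M \<union> N) \<sigma> v) =
      tensor_map (P M (restrict \<sigma> M)) (P N (restrict \<sigma> N)) (\<Delta> M N v)"
    and assoc: "finite L \<Longrightarrow> finite M \<Longrightarrow> finite N \<Longrightarrow>
      L \<inter> M = {} \<Longrightarrow> L \<inter> N = {} \<Longrightarrow> M \<inter> N = {} \<Longrightarrow>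
      t \<in> free_space ((B L \<times> B M) \<times> B N) \<Longrightarrow>
      \<mu> (L \<union> M) N (tensor_map (\<mu> L M) id t) =
      \<mu> L (M \<union> N) (tensor_map id (\<mu> M N) (tensor_assoc t))"
    and coassoc: "finite L \<Longrightarrow> finite M \<Longrightarrow> finite N \<Longrightarrow>
      L \<inter> M = {} \<Longrightarrow> L \<inter> N = {} \<Longrightarrow> M \<inter> N = {} \<Longrightarrow>
      v \<in> free_space (B (L \<union> M \<union> N)) \<Longrightarrow>
      tensor_assoc (tensor_map (\<Delta> L M) id (\<Delta> (L \<union> M) N v)) =
      tensor_map id (\<Delta> M N) (\<Delta> L (M \<union> N) v)"
    and unit_left: "finite N \<Longrightarrow> v \<in> free_space (B N) \<Longrightarrow> \<mu> {} N (tensor \<iota> v) = v"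
    and unit_right: "finite N \<Longrightarrow> v \<in> free_space (B N) \<Longrightarrow> \<mu> N {} (tensor v \<iota>) = v"
    and counit_left: "finite N \<Longrightarrow> v \<in> free_space (B N) \<Longrightarrow> contract_left \<epsilon> (\<Delta> {} N v) = v"
    and counit_right: "finite N \<Longrightarrow> v \<in> free_space (B N) \<Longrightarrow> contract_right \<epsilon> (\<Delta> N {} v) = v"
    and compatibility: "finite A \<Longrightarrow> finite B' \<Longrightarrow> finite C \<Longrightarrow> finite D \<Longrightarrow>
      A \<inter> B' = {} \<Longrightarrow> A \<inter> C = {} \<Longrightarrow> A \<inter> D = {} \<Longrightarrow>
      B' \<inter> C = {} \<Longrightarrow> B' \<inter> D = {} \<Longrightarrow> C \<inter> D = {} \<Longrightarrow>
      u \<in> free_space (B (A \<union> B') \<times> B (C \<union> D)) \<Longrightarrow>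
      \<Delta> (A \<union> C) (B' \<union> D) (\<mu> (A \<union> B') (C \<union> D) u) =
      tensor_map (\<mu> A C) (\<mu> B' D) (tensor_interchange (tensor_map (\<Delta> A B') (\<Delta> C D) u))"
    and \<Delta>_unit: "\<Delta> {} {} \<iota> = tensor \<iota> \<iota>"
    and \<epsilon>_mult: "v \<in> free_space (B {}) \<Longrightarrow> w \<in> free_space (B {}) \<Longrightarrow>
      \<epsilon> (\<mu> {} {} (tensor v w)) = \<epsilon> v * \<epsilon> w"
    and \<epsilon>_unit: "\<epsilon> \<iota> = 1"

text \<open>\<open>com M N h = Some (h|M, h/M)\<close>, or \<open>None\<close> if \<open>\<Delta>\<^bsub>M,N\<^esub>(h) = 0\<close>. The
  argument of type \<open>'k itself\<close> only names the ground field.\<close>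

definition hopf_linearization ::
    "'k::field itself \<Rightarrow> ('a::infinite set \<Rightarrow> 'h set) \<Rightarrow> ('a set \<Rightarrow> ('a \<Rightarrow> 'a) \<Rightarrow> 'h \<Rightarrow> 'h) \<Rightarrow>
     ('a set \<Rightarrow> 'a set \<Rightarrow> 'h \<Rightarrow> 'h \<Rightarrow> 'h) \<Rightarrow>
     ('a set \<Rightarrow> 'a set \<Rightarrow> 'h \<Rightarrow> ('h \<times> 'h) option) \<Rightarrow> bool" where
  "hopf_linearization K H Hmap mul com \<longleftrightarrow>
     (\<exists>(\<iota> :: 'h \<Rightarrow>\<^sub>0 'k) \<epsilon>.
       connected_hopf_monoid H (\<lambda>M \<sigma>. lin (Hmap M \<sigma>))
         (\<lambda>M N. lin (\<lambda>(x, y). mul M N x y)) (\<lambda>M N. lin0 (com M N)) \<iota> \<epsilon>)"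

locale linearized_hopf_monoid = set_species H Hmap
  for H :: "'a::infinite set \<Rightarrow> 'h set"
    and Hmap :: "'a set \<Rightarrow> ('a \<Rightarrow> 'a) \<Rightarrow> 'h \<Rightarrow> 'h" +
  fixes K :: "'k::field itself"
    and mul :: "'a set \<Rightarrow> 'a set \<Rightarrow> 'h \<Rightarrow> 'h \<Rightarrow> 'h"
    and com :: "'a set \<Rightarrow> 'a set \<Rightarrow> 'h \<Rightarrow> ('h \<times> 'h) option"
  assumes card_empty: "card (H {}) = 1"
    and mul_closed: "finite M \<Longrightarrow> finite N \<Longrightarrow> M \<inter> N = {} \<Longrightarrow> x \<in> H M \<Longrightarrow> y \<in> H N \<Longrightarrow>
      mul M N x y \<in> H (M \<union> N)"
    and com_closed: "finite M \<Longrightarrow> finite N \<Longrightarrow> M \<inter> N = {} \<Longrightarrow> h \<in> H (M \<union> N) \<Longrightarrow>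
      com M N h = Some (x, y) \<Longrightarrow> x \<in> H M \<and> y \<in> H N"
    and hopf_linearization: "hopf_linearization K H Hmap mul com"

locale linearized_combinatorial_hopf_monoid = linearized_hopf_monoid H Hmap K mul com
  for H :: "'a::infinite set \<Rightarrow> 'h set"
    and Hmap :: "'a set \<Rightarrow> ('a \<Rightarrow> 'a) \<Rightarrow> 'h \<Rightarrow> 'h"
    and K :: "'k::field itself"
    and mul :: "'a set \<Rightarrow> 'a set \<Rightarrow> 'h \<Rightarrow> 'h \<Rightarrow> 'h"
    and com :: "'a set \<Rightarrow> 'a set \<Rightarrow> 'h \<Rightarrow> ('h \<times> 'h) option" +
  fixes \<phi> :: "'a set \<Rightarrow> 'h \<Rightarrow> nat"
  assumes \<phi>_values: "finite N \<Longrightarrow> h \<in> H N \<Longrightarrow> \<phi> N h \<in> {0, 1}"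
    and \<phi>_natural: "finite M \<Longrightarrow> \<sigma> \<in> bijections M N \<Longrightarrow> h \<in> H M \<Longrightarrow> \<phi> N (Hmap M \<sigma> h) = \<phi> M h"
    and \<phi>_mult: "finite M \<Longrightarrow> finite N \<Longrightarrow> M \<inter> N = {} \<Longrightarrow> x \<in> H M \<Longrightarrow> y \<in> H N \<Longrightarrow>
      \<phi> (M \<union> N) (mul M N x y) = \<phi> M x * \<phi> N y"


section \<open>Set compositions and proper colorings\<close>

definition set_compositions :: "'a set \<Rightarrow> 'a set list set" where
  "set_compositions N = {C. distinct C \<and> partition_on N (set C)}"

definition comp_type :: "'a set list \<Rightarrow> nat list" where
  "comp_type C = map card C"

text \<open>The empty list is the only set composition of \<open>{}\<close>; it splits the structure on
  \<open>{}\<close> into zero parts, so that \<open>\<phi>\<^sub>C\<close> is an empty product there.\<close>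

fun com_list ::
    "('a set \<Rightarrow> 'a set \<Rightarrow> 'h \<Rightarrow> ('h \<times> 'h) option) \<Rightarrow> 'a set \<Rightarrow> 'a set list \<Rightarrow> 'h \<Rightarrow> 'h list option" where
  "com_list com N [] h = Some []"
| "com_list com N [S] h = Some [h]"
| "com_list com N (S # T # C) h =
     (case com S (N - S) h of
        None \<Rightarrow> None
      | Some (x, y) \<Rightarrow> map_option ((#) x) (com_list com (N - S) (T # C) y))"

definition \<phi>_comp ::
    "('a set \<Rightarrow> 'a set \<Rightarrow> 'h \<Rightarrow> ('h \<times> 'h) option) \<Rightarrow> ('a set \<Rightarrow> 'h \<Rightarrow> nat) \<Rightarrow>
     'a set \<Rightarrow> 'a set list \<Rightarrow> 'h \<Rightarrow> nat" where
  "\<phi>_comp com \<phi> N C h =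
     (case com_list com N C h of
        None \<Rightarrow> 0
      | Some hs \<Rightarrow> \<Prod>i<length C. \<phi> (C ! i) (hs ! i))"

definition comps_of_type ::
    "('a set \<Rightarrow> 'a set \<Rightarrow> 'h \<Rightarrow> ('h \<times> 'h) option) \<Rightarrow> ('a set \<Rightarrow> 'h \<Rightarrow> nat) \<Rightarrow>
     'a set \<Rightarrow> 'h \<Rightarrow> nat list \<Rightarrow> 'a set list set" where
  "comps_of_type com \<phi> N h \<alpha> =
     {C \<in> set_compositions N. comp_type C = \<alpha> \<and> \<phi>_comp com \<phi> N C h = 1}"

definition color_comp :: "'a set \<Rightarrow> ('a \<Rightarrow> nat) \<Rightarrow> 'a set list" where
  "color_comp N f = map (\<lambda>i. {v \<in> N. f v = i}) (sorted_list_of_set (f ` N))"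

text \<open>The indeterminates are \<open>x\<^sub>1, x\<^sub>2, \<dots>\<close>, so colors are positive. A coloring is
  \<open>undefined\<close> outside \<open>N\<close>.\<close>

definition proper_colorings ::
    "('a set \<Rightarrow> 'a set \<Rightarrow> 'h \<Rightarrow> ('h \<times> 'h) option) \<Rightarrow> ('a set \<Rightarrow> 'h \<Rightarrow> nat) \<Rightarrow>
     'a set \<Rightarrow> 'h \<Rightarrow> ('a \<Rightarrow> nat) set" where
  "proper_colorings com \<phi> N h =
     {f \<in> N \<rightarrow>\<^sub>E {1..}. \<phi>_comp com \<phi> N (color_comp N f) h = 1}"


section \<open>Group actions\<close>

definition aut :: "('a set \<Rightarrow> ('a \<Rightarrow> 'a) \<Rightarrow> 'h \<Rightarrow> 'h) \<Rightarrow> 'a set \<Rightarrow> 'h \<Rightarrow> ('a \<Rightarrow> 'a) set" where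
  "aut Hmap N h = stabilizer (BijGroup N) (Hmap N) h"

abbreviation perm_group :: "'a set \<Rightarrow> ('a \<Rightarrow> 'a) set \<Rightarrow> ('a \<Rightarrow> 'a) monoid" where
  "perm_group N G \<equiv> (BijGroup N)\<lparr>carrier := G\<rparr>"

definition color_act :: "'a set \<Rightarrow> ('a \<Rightarrow> 'a) \<Rightarrow> ('a \<Rightarrow> nat) \<Rightarrow> ('a \<Rightarrow> nat)" where
  "color_act N g f = compose N f (inv\<^bsub>BijGroup N\<^esub> g)"

definition comp_act :: "('a \<Rightarrow> 'a) \<Rightarrow> 'a set list \<Rightarrow> 'a set list" where
  "comp_act g C = map ((`) g) C"


section \<open>Quasisymmetric functions\<close>

text \<open>
  A formal power series in \<open>x\<^sub>1, x\<^sub>2, \<dots>\<close> is the function that maps a monomial,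
  given by its exponents, to the coefficient. (Exponents are indexed by \<open>nat\<close>, but the index
  \<open>0\<close> never occurs below.)
\<close>

type_synonym monomial = "nat \<Rightarrow>\<^sub>0 nat"
type_synonym series = "monomial \<Rightarrow> rat"

text \<open>The sum of the monomials \<open>w i\<close> over a possibly infinite index set \<open>I\<close>; every
  monomial must occur only finitely often.\<close>

definition monomial_sum :: "'i set \<Rightarrow> ('i \<Rightarrow> monomial) \<Rightarrow> series" where
  "monomial_sum I w = (\<lambda>m. of_nat (card {i \<in> I. w i = m}))"

definition int_compositions :: "nat \<Rightarrow> nat list set" where
  "int_compositions n = {\<alpha>. 0 \<notin> set \<alpha> \<and> sum_list \<alpha> = n}"

definition monomial_qsym :: "nat list \<Rightarrow> series" where
  "monomial_qsym \<alpha> = monomial_sum {is. length is = length \<alpha> \<and> 0 \<notin> set is \<and> sorted_wrt (<) is}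
           (\<lambda>is. \<Sum>j<length \<alpha>. Poly_Mapping.single (is ! j) (\<alpha> ! j))"

definition M_expansion :: "series \<Rightarrow> (nat list \<Rightarrow>\<^sub>0 rat) \<Rightarrow> bool" where
  "M_expansion F c \<longleftrightarrow>
     Poly_Mapping.keys c \<subseteq> (\<Union>n. int_compositions n) \<and>
     F = (\<lambda>m. \<Sum>\<alpha>\<in>Poly_Mapping.keys c. Poly_Mapping.lookup c \<alpha> * monomial_qsym \<alpha> m)"

definition M_coeff :: "series \<Rightarrow> nat list \<Rightarrow> rat" where
  "M_coeff F \<alpha> = Poly_Mapping.lookup (THE c. M_expansion F c) \<alpha>"

text \<open>Value of \<open>F\<close> at \<open>x\<^sub>i = 1\<close> for \<open>i \<le> n\<close> and \<open>x\<^sub>i = 0\<close> for \<open>i > n\<close>; the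
  sum is finite for \<open>F\<close> of bounded degree.\<close>

definition specialize :: "series \<Rightarrow> nat \<Rightarrow> rat" where
  "specialize F n = (\<Sum>m | Poly_Mapping.keys m \<subseteq> {1..n} \<and> F m \<noteq> 0. F m)"

definition ps :: "series \<Rightarrow> rat poly" where
  "ps F = (THE p. \<forall>n. poly p (of_nat n) = specialize F n)"


section \<open>Chromatic quasisymmetric functions and polynomials\<close>

definition color_monomial :: "'a set \<Rightarrow> ('a \<Rightarrow> nat) \<Rightarrow> monomial" where
  "color_monomial N f = (\<Sum>v\<in>N. Poly_Mapping.single (f v) 1)"

definition orbit_monomial :: "'a set \<Rightarrow> ('a \<Rightarrow> nat) set \<Rightarrow> monomial" where
  "orbit_monomial N Orb = color_monomial N (SOME f. f \<in> Orb)"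

definition chromatic_qsym ::
    "('a set \<Rightarrow> 'a set \<Rightarrow> 'h \<Rightarrow> ('h \<times> 'h) option) \<Rightarrow> ('a set \<Rightarrow> 'h \<Rightarrow> nat) \<Rightarrow>
     'a set \<Rightarrow> 'h \<Rightarrow> ('a \<Rightarrow> 'a) \<Rightarrow> series" where
  "chromatic_qsym com \<phi> N h g =
     monomial_sum (invariants (proper_colorings com \<phi> N h) (color_act N) g) (color_monomial N)"

definition chromatic_count ::
    "('a set \<Rightarrow> 'a set \<Rightarrow> 'h \<Rightarrow> ('h \<times> 'h) option) \<Rightarrow> ('a set \<Rightarrow> 'h \<Rightarrow> nat) \<Rightarrow>
     'a set \<Rightarrow> 'h \<Rightarrow> nat \<Rightarrow> ('a \<Rightarrow> 'a) \<Rightarrow> nat" where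
  "chromatic_count com \<phi> N h n g =
     card (invariants {f \<in> proper_colorings com \<phi> N h. f ` N \<subseteq> {1..n}} (color_act N) g)"

definition orbital_chromatic_qsym ::
    "('a set \<Rightarrow> 'a set \<Rightarrow> 'h \<Rightarrow> ('h \<times> 'h) option) \<Rightarrow> ('a set \<Rightarrow> 'h \<Rightarrow> nat) \<Rightarrow>
     'a set \<Rightarrow> 'h \<Rightarrow> ('a \<Rightarrow> 'a) set \<Rightarrow> series" where
  "orbital_chromatic_qsym com \<phi> N h G =
     monomial_sum (orbits (perm_group N G) (proper_colorings com \<phi> N h) (color_act N))
       (orbit_monomial N)"

definition orbital_chromatic_count ::
    "('a set \<Rightarrow> 'a set \<Rightarrow> 'h \<Rightarrow> ('h \<times> 'h) option) \<Rightarrow> ('a set \<Rightarrow> 'h \<Rightarrow> nat) \<Rightarrow>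
     'a set \<Rightarrow> 'h \<Rightarrow> ('a \<Rightarrow> 'a) set \<Rightarrow> nat \<Rightarrow> nat" where
  "orbital_chromatic_count com \<phi> N h G n =
     card (orbits (perm_group N G) {f \<in> proper_colorings com \<phi> N h. f ` N \<subseteq> {1..n}} (color_act N))"

end

(*
  By naturality of the coproduct and of the character, an automorphism of h permutes the set
  compositions C with phi_C(h) = 1 and therefore the proper colorings. Burnside's lemma, applied
  to the finite set of proper colorings with a given monomial or with colors in [n], gives the two
  averaging formulas. A coloring f is determined by its image and by C(f); for a fixed image
  S of size k, the map f -> C(f) is an equivariant bijection onto the set compositions with k blocks.
  So the coefficient of a monomial with exponent sequence alpha is the number of orbits of
  set compositions of type alpha, and the number of orbits of colorings in [n] is
  sum_k (n choose k) a_k, where a_k counts the orbits of set compositions with k blocks. This is a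
  polynomial in n.
*)

theory Submission
  imports Defs
begin

section \<open>Naturality of the coproduct on basis elements\<close>

lemma scale_1 [simp]: "scale 1 v = v"
  by (rule poly_mapping_eqI) (simp add: scale_def map.rep_eq when_def)

lemma linear_ext_0 [simp]: "linear_ext f 0 = 0"
  by (simp add: linear_ext_def)

lemma linear_ext_single [simp]:
  "linear_ext f (Poly_Mapping.single x (1 :: 'k::field)) = f x"
  by (simp add: linear_ext_def)

lemma lin_single [simp]:
  "lin f (Poly_Mapping.single x (1 :: 'k::field)) = Poly_Mapping.single (f x) 1"
  by (simp add: lin_def lin0_def)

lemma tensor_single [simp]:
  "tensor (Poly_Mapping.single x (1 :: 'k::field)) (Poly_Mapping.single y 1) =
   Poly_Mapping.single (x, y) 1"
  by (simp add: tensor_def)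

lemma single_one_eq_iff [simp]:
  "Poly_Mapping.single x (1 :: 'k::field) = Poly_Mapping.single y 1 \<longleftrightarrow> x = y"
  by (metis keys_single singleton_inject zero_neq_one)

lemma single_one_neq_0 [simp]: "Poly_Mapping.single x (1 :: 'k::field) \<noteq> 0"
  by (metis keys_single keys_zero insert_not_empty zero_neq_one)

lemma restrict_bijections:
  assumes "\<sigma> \<in> bijections N L" and "M \<subseteq> N"
  shows "restrict \<sigma> M \<in> bijections M (\<sigma> ` M)"
  using assms unfolding bijections_def by (auto simp: bij_betw_def inj_on_def)

context linearized_hopf_monoid
begin

text \<open>The linear naturality axiom is evaluated at the basis vector of \<open>h\<close>. Both
  sides become a basis vector or 0, and a basis vector is nonzero and determines its index, so the
  identity descends to the option-valued map.\<close>

lemma com_natural: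
  assumes "finite M" "finite N" "M \<inter> N = {}"
    and \<sigma>: "\<sigma> \<in> bijections (M \<union> N) L" and h: "h \<in> H (M \<union> N)"
  shows "com (\<sigma> ` M) (\<sigma> ` N) (Hmap (M \<union> N) \<sigma> h) =
    map_option (map_prod (Hmap M (restrict \<sigma> M)) (Hmap N (restrict \<sigma> N))) (com M N h)"
proof -
  obtain \<iota> :: "'h \<Rightarrow>\<^sub>0 'k" and \<epsilon> where
    hopf: "connected_hopf_monoid H (\<lambda>M \<sigma>. lin (Hmap M \<sigma>))
      (\<lambda>M N. lin (\<lambda>(x, y). mul M N x y)) (\<lambda>M N. lin0 (com M N)) \<iota> \<epsilon>"
    using hopf_linearization unfolding hopf_linearization_def by blast
  have "Poly_Mapping.single h (1 :: 'k) \<in> free_space (H (M \<union> N))"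
    using h by (simp add: free_space_def)
  from connected_hopf_monoid.\<Delta>_natural[OF hopf assms(1-3) \<sigma> this]
  have "lin0 (com (\<sigma> ` M) (\<sigma> ` N)) (Poly_Mapping.single (Hmap (M \<union> N) \<sigma> h) (1 :: 'k)) =
    tensor_map (lin (Hmap M (restrict \<sigma> M))) (lin (Hmap N (restrict \<sigma> N)))
      (lin0 (com M N) (Poly_Mapping.single h 1))"
    by simp
  then show ?thesis
    by (auto simp: lin0_def tensor_map_def split: option.splits)
qed

end


section \<open>Invariance of the character on set compositions\<close>

lemma \<phi>_comp_Nil [simp]: "\<phi>_comp com \<phi> N [] h = 1"
  by (simp add: \<phi>_comp_def)

lemma \<phi>_comp_single [simp]: "\<phi>_comp com \<phi> N [S] h = \<phi> S h"
  by (simp add: \<phi>_comp_def)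

text \<open>Peels the first factor off the indexed product, following the recursion of
  \<open>com_list\<close>; in this form the invariance can be proved by induction on the
  composition.\<close>

lemma \<phi>_comp_Cons:
  "\<phi>_comp com \<phi> N (S # T # C) h =
    (case com S (N - S) h of
       None \<Rightarrow> 0
     | Some (x, y) \<Rightarrow> \<phi> S x * \<phi>_comp com \<phi> (N - S) (T # C) y)"
  by (auto simp: \<phi>_comp_def prod.lessThan_Suc_shift simp del: prod.lessThan_Suc split: option.splits)

lemma set_compositions_Nil [simp]: "[] \<in> set_compositions N \<longleftrightarrow> N = {}"
  by (auto simp: set_compositions_def partition_on_def)

lemma set_compositions_Cons [simp]:
  "S # C \<in> set_compositions N \<longleftrightarrow> S \<noteq> {} \<and> S \<subseteq> N \<and> C \<in> set_compositions (N - S)"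
  (is "?L \<longleftrightarrow> ?R")
proof
  assume ?L
  then show ?R
    by (auto simp: set_compositions_def partition_on_def disjoint_def)
next
  assume ?R
  then show ?L
    by (auto simp: set_compositions_def partition_on_def disjoint_def)
qed

text \<open>Splitting off the first block commutes with relabelling by \<open>com_natural\<close>;
  the first factor is then handled by \<open>\<phi>_natural\<close> and the rest by induction. The
  ground set and the bijection are generalized because the recursion passes to the complement of the
  block and to the restricted bijection.\<close>

lemma (in linearized_combinatorial_hopf_monoid) \<phi>_comp_natural:
  assumes "finite N" "\<sigma> \<in> bijections N L" "h \<in> H N" "C \<in> set_compositions N"
  shows "\<phi>_comp com \<phi> L (map ((`) \<sigma>) C) (Hmap N \<sigma> h) = \<phi>_comp com \<phi> N C h"
  using assms
proof (induction C arbitrary: N \<sigma> L h rule: induct_list012)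
  case 1
  then show ?case by simp
next
  case (2 S)
  \<comment> \<open>A composition with a single block consists of the whole ground set, so
    naturality of the character applies directly.\<close>
  then have "S = N" and "\<sigma> ` N = L"
    by (auto simp: bijections_def bij_betw_def)
  with 2 show ?case by (auto intro!: \<phi>_natural)
next
  case (3 S T C)
  let ?R = "N - S"
  have S: "S \<subseteq> N" and C: "T # C \<in> set_compositions ?R"
    using "3.prems"(4) by auto
  have fin: "finite S" "finite ?R" and N: "S \<union> ?R = N"
    using S "3.prems"(1) finite_subset by auto
  have inj: "inj_on \<sigma> N" and "\<sigma> ` N = L"
    using "3.prems"(2) by (auto simp: bijections_def bij_betw_def)
  then have img: "\<sigma> ` ?R = L - \<sigma> ` S"
    using S by (simp add: inj_on_image_set_diff)
  have nat: "com (\<sigma> ` S) (L - \<sigma> ` S) (Hmap N \<sigma> h) =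
      map_option (map_prod (Hmap S (restrict \<sigma> S)) (Hmap ?R (restrict \<sigma> ?R))) (com S ?R h)"
    using com_natural[of S ?R \<sigma> L h] fin "3.prems" unfolding N img by simp
  show ?case
  proof (cases "com S ?R h")
    case None
    then show ?thesis by (simp add: \<phi>_comp_Cons nat)
  next
    case (Some p)
    obtain x y where xy: "com S ?R h = Some (x, y)"
      using Some by (cases p) auto
    have mem: "x \<in> H S" "y \<in> H ?R"
      using com_closed[of S ?R h x y] fin "3.prems"(3) xy unfolding N by auto
    have "\<phi> (\<sigma> ` S) (Hmap S (restrict \<sigma> S) x) = \<phi> S x"
      using \<phi>_natural restrict_bijections[OF "3.prems"(2) S] fin mem by blast
    \<comment> \<open>The induction hypothesis speaks of the restricted bijection, the goal of
      \<sigma> itself; they agree because the remaining blocks lie in \<open>?R\<close>.\<close>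
    moreover have "map ((`) (restrict \<sigma> ?R)) (T # C) = map ((`) \<sigma>) (T # C)"
    proof (rule map_cong[OF refl])
      fix U assume "U \<in> set (T # C)"
      then have "U \<subseteq> ?R"
        using C by (auto simp: set_compositions_def partition_on_def)
      then show "restrict \<sigma> ?R ` U = \<sigma> ` U" by (intro image_cong) auto
    qed
    then have "\<phi>_comp com \<phi> (\<sigma> ` ?R) (map ((`) \<sigma>) (T # C))
        (Hmap ?R (restrict \<sigma> ?R) y) = \<phi>_comp com \<phi> ?R (T # C) y"
      using "3.IH"(2)[OF fin(2) restrict_bijections[OF "3.prems"(2), of ?R] mem(2) C]
      by (metis Diff_subset)
    ultimately show ?thesis
      by (simp add: \<phi>_comp_Cons nat xy img)
  qed
qed


section \<open>Group actions and their orbits\<close>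

text \<open>
  \<open>group_action\<close> requires maps that are \<open>undefined\<close> outside the set acted upon, which
  \<open>color_act N\<close> and \<open>comp_act\<close> are not; orbits and invariants do not see the difference.
\<close>

locale set_action = group P for P (structure) +
  fixes E :: "'x set" and act :: "'g \<Rightarrow> 'x \<Rightarrow> 'x"
  constrains P :: "('g, 'm) monoid_scheme"
  assumes act_closed: "g \<in> carrier P \<Longrightarrow> x \<in> E \<Longrightarrow> act g x \<in> E"
    and act_one: "x \<in> E \<Longrightarrow> act \<one> x = x"
    and act_mult: "g \<in> carrier P \<Longrightarrow> k \<in> carrier P \<Longrightarrow> x \<in> E \<Longrightarrow> act (g \<otimes> k) x = act g (act k x)"
begin

text \<open>Acting by \<open>inv g\<close> undoes acting by \<open>g\<close>, so each restricted map
  is a permutation of \<open>E\<close>, and the action laws give a homomorphism into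
  \<open>BijGroup E\<close>. This makes the library's Burnside lemma available.\<close>

lemma restricted_action: "group_action P E (\<lambda>g. restrict (act g) E)"
proof -
  have inverse: "act (inv g) (act g x) = x" "act g (act (inv g) x) = x"
    if "g \<in> carrier P" "x \<in> E" for g x
    using that by (metis act_mult act_one inv_closed l_inv r_inv)+
  have bij: "restrict (act g) E \<in> Bij E" if g: "g \<in> carrier P" for g
  proof -
    have "bij_betw (act g) E E"
      by (rule bij_betw_byWitness[where f' = "act (inv g)"])
        (use g inverse act_closed in \<open>auto simp: image_subset_iff\<close>)
    then show ?thesis by (simp add: Bij_def cong: bij_betw_cong)
  qed
  have "restrict (act (g \<otimes> k)) E = compose E (restrict (act g) E) (restrict (act k) E)"
    if "g \<in> carrier P" "k \<in> carrier P" for g k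
    using that by (auto simp: compose_def act_mult act_closed)
  then have "(\<lambda>g. restrict (act g) E) \<in> hom P (BijGroup E)"
    by (auto intro!: homI simp: BijGroup_def bij)
  then show ?thesis
    by (simp add: group_action_def group_hom_def group_hom_axioms_def group_BijGroup
        is_group)
qed

lemma orbits_restrict: "orbits P E (\<lambda>g. restrict (act g) E) = orbits P E act"
proof -
  have "orbit P (\<lambda>g. restrict (act g) E) x = orbit P act x" if "x \<in> E" for x
    using that by (simp add: orbit_def)
  then show ?thesis by (auto simp: orbits_def)
qed

lemma burnside:
  assumes "finite (carrier P)" "finite E"
  shows "card (orbits P E act) * Coset.order P = (\<Sum>g\<in>carrier P. card (invariants E act g))"
proof -
  have "invariants E (\<lambda>g. restrict (act g) E) g = invariants E act g" for g
    by (auto simp: invariants_def)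
  with group_action.burnside[OF restricted_action assms] show ?thesis
    by (simp add: orbits_restrict)
qed

lemma orbit_refl: "x \<in> E \<Longrightarrow> x \<in> orbit P act x"
  unfolding orbit_def by (rule CollectI, rule exI[of _ \<one>]) (simp add: act_one)

lemma orbit_subset: "x \<in> E \<Longrightarrow> orbit P act x \<subseteq> E"
  by (auto simp: orbit_def act_closed)

text \<open>The set of all colorings is usually infinite; counting takes place on invariant subsets
  cut out by a monomial or by the colors used.\<close>

lemma set_action_fibre:
  assumes "\<And>g x. g \<in> carrier P \<Longrightarrow> x \<in> E \<Longrightarrow> Q (act g x) \<longleftrightarrow> Q x"
  shows "set_action P {x \<in> E. Q x} act"
  by unfold_locales (use assms act_closed act_one act_mult in auto)

text \<open>Equivariance carries the orbit of \<open>x\<close> onto the orbit of \<open>b x\<close>,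
  and taking images under \<open>b\<close> is injective on subsets of \<open>E\<close>.\<close>

lemma card_orbits_bij_betw:
  assumes b: "bij_betw b E E'"
    and equi: "\<And>g x. g \<in> carrier P \<Longrightarrow> x \<in> E \<Longrightarrow> act' g (b x) = b (act g x)"
  shows "card (orbits P E' act') = card (orbits P E act)"
proof -
  have "orbit P act' (b x) = b ` orbit P act x" if "x \<in> E" for x
  proof -
    have "orbit P act' (b x) = (\<lambda>g. act' g (b x)) ` carrier P"
      by (auto simp: orbit_def)
    also have "\<dots> = (\<lambda>g. b (act g x)) ` carrier P"
      using equi that by (intro image_cong) auto
    also have "\<dots> = b ` orbit P act x"
      by (auto simp: orbit_def)
    finally show ?thesis .
  qed
  moreover have "E' = b ` E"
    using b by (simp add: bij_betw_def)
  ultimately have "orbits P E' act' = (`) b ` orbits P E act"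
    unfolding orbits_def Setcompr_eq_image image_image by (simp add: image_image)
  moreover have "orbits P E act \<subseteq> Pow E"
    using orbit_subset by (auto simp: orbits_def)
  then have "inj_on ((`) b) (orbits P E act)"
    using b inj_on_image_Pow inj_on_subset by (metis bij_betw_def)
  ultimately show ?thesis by (simp add: card_image)
qed

text \<open>An invariant \<open>w\<close> is constant on each orbit, so every orbit lies in exactly
  one fibre.\<close>

lemma card_orbits_fibres:
  assumes inv: "\<And>g x. g \<in> carrier P \<Longrightarrow> x \<in> E \<Longrightarrow> w (act g x) = w x"
    and "finite E" "finite I" "w ` E \<subseteq> I"
  shows "card (orbits P E act) = (\<Sum>c\<in>I. card (orbits P {x \<in> E. w x = c} act))"
proof -
  have orb: "w y = w x" if "x \<in> E" "y \<in> orbit P act x" for x y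
    using that inv by (auto simp: orbit_def)
  have fibre: "orbits P {x \<in> E. w x = c} act = orbit P act ` {x \<in> E. w x = c}" for c
    unfolding orbits_def Setcompr_eq_image by (rule refl)
  have "orbits P E act = orbit P act ` E"
    unfolding orbits_def Setcompr_eq_image by (rule refl)
  also have "\<dots> = orbit P act ` (\<Union>c\<in>I. {x \<in> E. w x = c})"
    using assms(4) by (intro arg_cong[where f = "(`) (orbit P act)"]) auto
  also have "\<dots> = (\<Union>c\<in>I. orbits P {x \<in> E. w x = c} act)"
    by (simp only: image_UN fibre)
  also have "card \<dots> = (\<Sum>c\<in>I. card (orbits P {x \<in> E. w x = c} act))"
  proof (rule card_UN_disjoint)
    show "\<forall>c\<in>I. finite (orbits P {x \<in> E. w x = c} act)"
      using \<open>finite E\<close> by (simp add: fibre)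
    show "\<forall>c\<in>I. \<forall>d\<in>I. c \<noteq> d \<longrightarrow>
        orbits P {x \<in> E. w x = c} act \<inter> orbits P {x \<in> E. w x = d} act = {}"
    proof (intro ballI impI equals0I)
      fix c d Y
      assume "c \<noteq> d" and Y: "Y \<in> orbits P {x \<in> E. w x = c} act \<inter> orbits P {x \<in> E. w x = d} act"
      from Y obtain x where x: "x \<in> E" "w x = c" "Y = orbit P act x"
        unfolding fibre by blast
      from Y obtain y where y: "y \<in> E" "w y = d" "Y = orbit P act y"
        unfolding fibre by blast
      \<comment> \<open>A common orbit would contain both \<open>x\<close> and \<open>y\<close>,
        although \<open>w\<close> takes different values on them.\<close>
      have "y \<in> orbit P act x"
        using orbit_refl[OF y(1)] x(3) y(3) by simp
      then show False
        using orb[OF x(1)] x(2) y(2) \<open>c \<noteq> d\<close> by simp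
    qed
  qed (fact \<open>finite I\<close>)
  finally show ?thesis .
qed

end


section \<open>Colorings and set compositions\<close>

lemma set_composition_nth_disjoint:
  assumes "C \<in> set_compositions N" "i < length C" "j < length C" "v \<in> C ! i" "v \<in> C ! j"
  shows "i = j"
proof (rule ccontr)
  assume "i \<noteq> j"
  then have "C ! i \<noteq> C ! j"
    using assms by (simp add: set_compositions_def nth_eq_iff_index_eq)
  moreover have "C ! i \<in> set C" "C ! j \<in> set C"
    using assms by auto
  ultimately show False
    using assms(1,4,5) by (auto simp: set_compositions_def dest!: partition_onD2 dest: disjointD)
qed

lemma color_comp_set_compositions:
  assumes "finite N"
  shows "color_comp N f \<in> set_compositions N"
proof -
  have "inj_on (\<lambda>i. {v \<in> N. f v = i}) (f ` N)"
    by (rule inj_onI) blast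
  then show ?thesis
    using assms by (auto simp: set_compositions_def color_comp_def distinct_map
        partition_on_def disjoint_def)
qed

text \<open>Once the image is fixed to be \<open>S\<close>, the position of a block in the list
  determines its color: the i-th block carries the i-th smallest element of
  \<open>S\<close>.\<close>

lemma bij_betw_color_comp:
  assumes "finite N" "finite S"
  shows "bij_betw (color_comp N) {f \<in> extensional N. f ` N = S}
    {C \<in> set_compositions N. length C = card S}"
    (is "bij_betw _ ?A ?B")
proof (rule bij_betw_imageI)
  show "inj_on (color_comp N) ?A"
  proof (rule inj_onI)
    fix f g assume f: "f \<in> ?A" and g: "g \<in> ?A" and eq: "color_comp N f = color_comp N g"
    show "f = g"
    proof (rule extensionalityI)
      fix v assume "v \<in> N"
      with f have "f v \<in> S" by auto
      \<comment> \<open>Both lists are indexed by the same sorted list of \<open>S\<close>, so equal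
        lists have the same class for each color in \<open>S\<close>.\<close>
      then have "{u \<in> N. f u = f v} = {u \<in> N. g u = f v}"
        using eq f g \<open>finite S\<close> by (simp add: color_comp_def)
      then show "f v = g v" using \<open>v \<in> N\<close> by force
    qed (use f g in auto)
  qed
  show "color_comp N ` ?A = ?B"
  proof (intro equalityI subsetI)
    fix C assume "C \<in> color_comp N ` ?A"
    then show "C \<in> ?B"
      using color_comp_set_compositions[OF \<open>finite N\<close>] by (auto simp: color_comp_def)
  next
    fix C assume "C \<in> ?B"
    then have C: "C \<in> set_compositions N" and len: "length C = card S" by auto
    define s where "s = sorted_list_of_set S"
    have s: "length s = length C" "set s = S" "distinct s"
      using \<open>finite S\<close> by (simp_all add: s_def len)
    \<comment> \<open>The inverse map: each vertex gets the element of \<open>S\<close> at the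
      position of its block. The position is unique because the blocks are disjoint.\<close>
    define f where "f = (\<lambda>v\<in>N. s ! (THE i. i < length C \<and> v \<in> C ! i))"
    have block: "C ! i \<subseteq> N" "C ! i \<noteq> {}" if "i < length C" for i
      using C nth_mem[OF that] by (auto simp: set_compositions_def partition_on_def)
    have f: "f v = s ! i" if "i < length C" "v \<in> C ! i" for i v
    proof -
      have "(THE i. i < length C \<and> v \<in> C ! i) = i"
        using that set_composition_nth_disjoint[OF C] by blast
      then show ?thesis using block that by (auto simp: f_def)
    qed
    have cover: "\<exists>i<length C. v \<in> C ! i" if "v \<in> N" for v
    proof -
      have "v \<in> \<Union> (set C)"
        using C that by (auto simp: set_compositions_def partition_on_def)
      then show ?thesis by (auto simp: in_set_conv_nth)
    qed
    have fibre: "{v \<in> N. f v = s ! i} = C ! i" if "i < length C" for i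
    proof (intro equalityI subsetI)
      fix v assume "v \<in> {v \<in> N. f v = s ! i}"
      then obtain j where j: "j < length C" "v \<in> C ! j" and "f v = s ! i"
        using cover by auto
      then have "s ! j = s ! i" using f by simp
      then have "j = i"
        using s that j by (simp add: nth_eq_iff_index_eq)
      then show "v \<in> C ! i" using j by simp
    qed (use f block that in auto)
    have "f ` N = S"
    proof (intro equalityI subsetI)
      fix x assume "x \<in> f ` N"
      then obtain v where "v \<in> N" "x = f v" by auto
      then obtain i where "i < length C" "x = s ! i" using cover f by metis
      then show "x \<in> S" using s nth_mem by fastforce
    next
      fix x assume "x \<in> S"
      then obtain i where i: "i < length C" "x = s ! i"
        using s by (auto simp: in_set_conv_nth)
      then obtain v where "v \<in> C ! i" using block[of i] by auto
      then have "v \<in> N" "f v = x" using f block i by auto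
      then show "x \<in> f ` N" by blast
    qed
    moreover from this have "color_comp N f = C"
      using s fibre by (auto simp: color_comp_def s_def[symmetric] intro!: nth_equalityI)
    moreover have "f \<in> extensional N"
      by (simp add: f_def)
    ultimately show "C \<in> color_comp N ` ?A" by blast
  qed
qed

text \<open>The nonzero exponents in increasing order of the variables. For monomials in the
  variables of positive index this is the composition \<alpha> whose \<open>monomial_qsym\<close>
  contains \<open>m\<close>.\<close>

definition exponents :: "monomial \<Rightarrow> nat list" where
  "exponents m = map (Poly_Mapping.lookup m) (sorted_list_of_set (Poly_Mapping.keys m))"

lemma lookup_color_monomial:
  assumes "finite N"
  shows "Poly_Mapping.lookup (color_monomial N f) i = card {v \<in> N. f v = i}"
proof -
  have "Poly_Mapping.lookup (color_monomial N f) i = (\<Sum>v\<in>N. if f v = i then Suc 0 else 0)"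
    by (simp add: color_monomial_def lookup_sum lookup_single when_def)
  also have "\<dots> = card {v \<in> N. f v = i}"
    using assms by (simp add: sum.If_cases Int_def)
  finally show ?thesis .
qed

lemma keys_color_monomial:
  assumes "finite N"
  shows "Poly_Mapping.keys (color_monomial N f) = f ` N"
  using assms by (auto simp: in_keys_iff lookup_color_monomial)

text \<open>The exponent of a color is the size of its class, and both lists run through the colors
  in increasing order.\<close>

lemma comp_type_color_comp:
  assumes "finite N"
  shows "comp_type (color_comp N f) = exponents (color_monomial N f)"
  using assms
  by (simp add: comp_type_def color_comp_def exponents_def keys_color_monomial
      lookup_color_monomial)

lemma exponents_inject:
  assumes "Poly_Mapping.keys m = Poly_Mapping.keys m'" "exponents m = exponents m'"
  shows "m = m'"
proof (rule poly_mapping_eqI)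
  fix i
  show "Poly_Mapping.lookup m i = Poly_Mapping.lookup m' i"
  proof (cases "i \<in> Poly_Mapping.keys m")
    case True
    then show ?thesis using assms by (simp add: exponents_def)
  next
    case False
    then have "i \<notin> Poly_Mapping.keys m'" using assms(1) by simp
    with False show ?thesis by (simp add: in_keys_iff)
  qed
qed

lemma exponents_pos: "0 \<notin> set (exponents m)"
  by (auto simp: exponents_def in_keys_iff)

lemma comp_type_set_composition:
  assumes "finite N" "C \<in> set_compositions N"
  shows "comp_type C \<in> int_compositions (card N)"
proof -
  have fin: "finite U" "U \<noteq> {}" if "U \<in> set C" for U
    using assms that by (auto simp: set_compositions_def partition_on_def intro: finite_subset)
  have "sum_list (comp_type C) = (\<Sum>U\<in>set C. card U)"
    using assms by (simp add: comp_type_def set_compositions_def sum_list_distinct_conv_sum_set)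
  also have "\<dots> = card (\<Union> (set C))"
    using assms fin
    by (intro card_Union_disjoint[symmetric])
      (auto simp: set_compositions_def partition_on_def disjoint_def pairwise_def disjnt_def)
  also have "\<Union> (set C) = N"
    using assms by (simp add: set_compositions_def partition_on_def)
  finally show ?thesis
    using fin by (auto simp: int_compositions_def comp_type_def)
qed


section \<open>Monomial quasisymmetric functions\<close>

lemma lookup_monomial_of_lists:
  assumes "distinct is" "length is = length \<alpha>"
  shows "Poly_Mapping.lookup (\<Sum>j<length \<alpha>. Poly_Mapping.single (is ! j) (\<alpha> ! j)) i =
    (\<Sum>j | j < length \<alpha> \<and> is ! j = i. \<alpha> ! j)"
  using assms
  by (auto simp: lookup_sum lookup_single when_def sum.If_cases intro!: sum.cong)

text \<open>Distinct indices keep the terms from merging and positive parts keep each index in the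
  support. So the monomial remembers the indices as its sorted support and the parts as its
  exponents.\<close>

lemma monomial_of_lists_eq_iff:
  assumes "sorted_wrt (<) is" "length is = length \<alpha>" "0 \<notin> set \<alpha>"
  shows "(\<Sum>j<length \<alpha>. Poly_Mapping.single (is ! j) (\<alpha> ! j)) = m \<longleftrightarrow>
    is = sorted_list_of_set (Poly_Mapping.keys m) \<and> exponents m = \<alpha>"
proof -
  define m' where "m' = (\<Sum>j<length \<alpha>. Poly_Mapping.single (is ! j) (\<alpha> ! j))"
  have dist: "distinct is"
    using assms(1) strict_sorted_iff by blast
  have at: "Poly_Mapping.lookup m' (is ! j) = \<alpha> ! j" if "j < length \<alpha>" for j
  proof -
    have "{k. k < length \<alpha> \<and> is ! k = is ! j} = {j}"
      using that dist assms(2) by (auto simp: nth_eq_iff_index_eq)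
    then show ?thesis
      unfolding m'_def lookup_monomial_of_lists[OF dist assms(2)] by simp
  qed
  have keys: "Poly_Mapping.keys m' = set is"
  proof (intro equalityI subsetI)
    fix i assume "i \<in> Poly_Mapping.keys m'"
    then have "{j. j < length \<alpha> \<and> is ! j = i} \<noteq> {}"
      unfolding m'_def in_keys_iff lookup_monomial_of_lists[OF dist assms(2)] by force
    then show "i \<in> set is" using assms(2) by auto
  next
    fix i assume "i \<in> set is"
    then obtain j where "j < length \<alpha>" "i = is ! j"
      using assms(2) by (auto simp: in_set_conv_nth)
    then show "i \<in> Poly_Mapping.keys m'"
      using at assms(3) nth_mem by (metis in_keys_iff)
  qed
  have "is = sorted_list_of_set (set is)"
    using assms(1) by (simp add: sorted_list_of_set.idem_if_sorted_distinct strict_sorted_iff)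
  then have list: "sorted_list_of_set (Poly_Mapping.keys m') = is"
    by (simp add: keys)
  have exps: "exponents m' = \<alpha>"
    unfolding exponents_def list using at assms(2) by (auto intro: nth_equalityI)
  show ?thesis
    unfolding m'_def[symmetric]
  proof
    assume "is = sorted_list_of_set (Poly_Mapping.keys m) \<and> exponents m = \<alpha>"
    then show "m' = m"
      using exponents_inject[of m' m] exps keys by simp
  qed (use list exps in auto)
qed

text \<open>At most one increasing index list produces \<open>m\<close>, namely its sorted support,
  so all coefficients are 0 or 1. The condition on 0 reflects that the variables start at index
  1.\<close>

lemma monomial_qsym_eq:
  assumes "0 \<notin> set \<alpha>"
  shows "monomial_qsym \<alpha> m =
    (if 0 \<notin> Poly_Mapping.keys m \<and> exponents m = \<alpha> then 1 else 0)"
proof -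
  let ?s = "sorted_list_of_set (Poly_Mapping.keys m)"
  have "is \<in> {is \<in> {is. length is = length \<alpha> \<and> 0 \<notin> set is \<and> sorted_wrt (<) is}.
      (\<Sum>j<length \<alpha>. Poly_Mapping.single (is ! j) (\<alpha> ! j)) = m} \<longleftrightarrow>
    is \<in> (if 0 \<notin> Poly_Mapping.keys m \<and> exponents m = \<alpha> then {?s} else {})" (is "?L \<longleftrightarrow> ?R") for "is"
  proof
    assume ?L
    then have "is = ?s" "exponents m = \<alpha>" "0 \<notin> set is"
      using assms monomial_of_lists_eq_iff[of "is" \<alpha> m] by auto
    then show ?R by simp
  next
    assume ?R
    then have "is = ?s" "exponents m = \<alpha>" "0 \<notin> Poly_Mapping.keys m"
      by (auto split: if_splits)
    moreover from this have "length ?s = length \<alpha>"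
      unfolding exponents_def by (metis length_map)
    ultimately show ?L
      using assms monomial_of_lists_eq_iff[of ?s \<alpha> m] by simp
  qed
  then have "{is \<in> {is. length is = length \<alpha> \<and> 0 \<notin> set is \<and> sorted_wrt (<) is}.
      (\<Sum>j<length \<alpha>. Poly_Mapping.single (is ! j) (\<alpha> ! j)) = m} =
    (if 0 \<notin> Poly_Mapping.keys m \<and> exponents m = \<alpha> then {?s} else {})"
    by blast
  then show ?thesis
    by (simp add: monomial_qsym_def monomial_sum_def)
qed

text \<open>Supplies a test monomial at which a coefficient can be read off: the parts of \<alpha>
  are placed on the variables with indices 1 to \<open>length \<alpha>\<close>.\<close>

lemma exponents_surj:
  assumes "0 \<notin> set \<alpha>"
  obtains m where "0 \<notin> Poly_Mapping.keys m" "exponents m = \<alpha>"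
proof -
  define s where "s = [1..<Suc (length \<alpha>)]"
  define m where "m = (\<Sum>j<length \<alpha>. Poly_Mapping.single (s ! j) (\<alpha> ! j))"
  have s: "sorted_wrt (<) s" "length s = length \<alpha>" "0 \<notin> set s"
    by (auto simp add: s_def simp del: upt_Suc)
  then have m: "s = sorted_list_of_set (Poly_Mapping.keys m)" "exponents m = \<alpha>"
    using monomial_of_lists_eq_iff[of s \<alpha> m] assms by (simp_all add: m_def)
  then have "0 \<notin> Poly_Mapping.keys m"
    using s(3) by simp
  then show thesis using m that by blast
qed

lemma M_expansion_lookup:
  assumes c: "M_expansion F c" and m: "0 \<notin> Poly_Mapping.keys m"
  shows "F m = Poly_Mapping.lookup c (exponents m)"
proof -
  have "F m = (\<Sum>\<alpha>\<in>Poly_Mapping.keys c. Poly_Mapping.lookup c \<alpha> * monomial_qsym \<alpha> m)"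
    using c by (simp add: M_expansion_def)
  also have "\<dots> = (\<Sum>\<alpha>\<in>Poly_Mapping.keys c.
      if \<alpha> = exponents m then Poly_Mapping.lookup c \<alpha> else 0)"
  proof (rule sum.cong[OF refl])
    fix \<alpha> assume "\<alpha> \<in> Poly_Mapping.keys c"
    then have "0 \<notin> set \<alpha>"
      using c by (auto simp: M_expansion_def int_compositions_def)
    then show "Poly_Mapping.lookup c \<alpha> * monomial_qsym \<alpha> m =
        (if \<alpha> = exponents m then Poly_Mapping.lookup c \<alpha> else 0)"
      using m by (simp add: monomial_qsym_eq)
  qed
  also have "\<dots> = Poly_Mapping.lookup c (exponents m)"
    by (simp add: sum.delta' in_keys_iff)
  finally show ?thesis .
qed

text \<open>Linear independence of the monomial quasisymmetric functions: each coefficient is the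
  value of \<open>F\<close> at a test monomial. This gives meaning to the definite description in
  \<open>M_coeff\<close>.\<close>

lemma M_expansion_unique:
  assumes "M_expansion F c" "M_expansion F c'"
  shows "c = c'"
proof (rule poly_mapping_eqI)
  fix \<alpha>
  show "Poly_Mapping.lookup c \<alpha> = Poly_Mapping.lookup c' \<alpha>"
  proof (cases "0 \<in> set \<alpha>")
    case True
    then have "\<alpha> \<notin> Poly_Mapping.keys c" "\<alpha> \<notin> Poly_Mapping.keys c'"
      using assms by (auto simp: M_expansion_def int_compositions_def)
    then show ?thesis by (simp add: in_keys_iff)
  next
    case False
    then obtain m where "0 \<notin> Poly_Mapping.keys m" "exponents m = \<alpha>"
      by (rule exponents_surj)
    then show ?thesis
      using assms[THEN M_expansion_lookup] by metis
  qed
qed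

lemma M_coeff_eq:
  assumes "M_expansion F c"
  shows "M_coeff F \<alpha> = Poly_Mapping.lookup c \<alpha>"
  unfolding M_coeff_def using assms M_expansion_unique by (metis the_equality)

lemma length_le_sum_list:
  fixes \<alpha> :: "nat list"
  assumes "0 \<notin> set \<alpha>"
  shows "length \<alpha> \<le> sum_list \<alpha>"
  using assms by (induction \<alpha>) auto

lemma finite_int_compositions: "finite (int_compositions n)"
proof (rule finite_subset)
  show "int_compositions n \<subseteq> {\<alpha>. set \<alpha> \<subseteq> {..n} \<and> length \<alpha> \<le> n}"
  proof
    fix \<alpha> assume "\<alpha> \<in> int_compositions n"
    then have \<alpha>: "0 \<notin> set \<alpha>" "sum_list \<alpha> = n" by (auto simp: int_compositions_def)
    then show "\<alpha> \<in> {\<alpha>. set \<alpha> \<subseteq> {..n} \<and> length \<alpha> \<le> n}"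
      using \<alpha> member_le_sum_list length_le_sum_list by auto
  qed
qed (simp add: finite_lists_length_le)

text \<open>The hypotheses express quasisymmetry and bounded support: \<open>F\<close> depends on a
  monomial only through its exponent list, and only finitely many lists contribute. Then
  \<open>a\<close> itself is the family of coefficients.\<close>

lemma M_coeff_eqI:
  assumes supp: "\<And>m. 0 \<in> Poly_Mapping.keys m \<Longrightarrow> F m = 0"
    and F: "\<And>m. 0 \<notin> Poly_Mapping.keys m \<Longrightarrow> F m = a (exponents m)"
    and fin: "finite {\<alpha>. a \<alpha> \<noteq> 0}"
    and "0 \<notin> set \<alpha>"
  shows "M_coeff F \<alpha> = a \<alpha>"
proof -
  \<comment> \<open>Lists with a zero part are not compositions, so \<open>a\<close> is cut off
    there; \<open>exponents\<close> never produces such a list.\<close>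
  define c where "c = Abs_poly_mapping (\<lambda>\<alpha>. if 0 \<in> set \<alpha> then 0 else a \<alpha>)"
  have lookup: "Poly_Mapping.lookup c = (\<lambda>\<alpha>. if 0 \<in> set \<alpha> then 0 else a \<alpha>)"
    unfolding c_def by (intro lookup_Abs_poly_mapping rev_finite_subset[OF fin]) auto
  have keys: "0 \<notin> set \<alpha>" if "\<alpha> \<in> Poly_Mapping.keys c" for \<alpha>
    using that by (auto simp: in_keys_iff lookup)
  have "F m = (\<Sum>\<alpha>\<in>Poly_Mapping.keys c. Poly_Mapping.lookup c \<alpha> * monomial_qsym \<alpha> m)" for m
  proof -
    have "(\<Sum>\<alpha>\<in>Poly_Mapping.keys c. Poly_Mapping.lookup c \<alpha> * monomial_qsym \<alpha> m) =
      (\<Sum>\<alpha>\<in>Poly_Mapping.keys c. if \<alpha> = exponents m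
         then (if 0 \<in> Poly_Mapping.keys m then 0 else Poly_Mapping.lookup c \<alpha>) else 0)"
      by (intro sum.cong refl) (auto simp: monomial_qsym_eq keys)
    also have "\<dots> = (if 0 \<in> Poly_Mapping.keys m then 0 else Poly_Mapping.lookup c (exponents m))"
      by (simp add: sum.delta in_keys_iff)
    also have "\<dots> = F m"
      using supp F by (simp add: lookup exponents_pos)
    finally show ?thesis by simp
  qed
  then have "M_expansion F c"
    using keys by (auto simp: M_expansion_def int_compositions_def)
  then show ?thesis
    using \<open>0 \<notin> set \<alpha>\<close> by (simp add: M_coeff_eq lookup)
qed


section \<open>Principal specialization\<close>

text \<open>A polynomial vanishing at every natural number is zero, so the values on the naturals
  determine \<open>p\<close>.\<close>

lemma ps_eqI:
  assumes "\<And>n. poly p (of_nat n) = specialize F n"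
  shows "ps F = p"
  unfolding ps_def
proof (rule the_equality)
  fix q assume q: "\<forall>n. poly q (of_nat n) = specialize F n"
  have "\<nat> \<subseteq> {x. poly (q - p) x = 0}"
    using q assms by (auto elim!: Nats_cases)
  moreover have "infinite (\<nat> :: rat set)"
    by (simp add: Nats_def range_inj_infinite inj_of_nat)
  ultimately have "q - p = 0"
    using poly_roots_finite finite_subset by blast
  then show "q = p" by simp
qed (use assms in simp)

definition binomial_poly :: "nat \<Rightarrow> rat poly" where
  "binomial_poly k = smult (1 / fact k) (\<Prod>i<k. [:- of_nat i, 1:])"

lemma poly_binomial_poly: "poly (binomial_poly k) (of_nat n) = of_nat (n choose k)"
proof -
  have "poly (binomial_poly k) (of_nat n) = (of_nat n gchoose k)"
    by (simp add: binomial_poly_def poly_prod gbinomial_prod_rev atLeast0LessThan)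
  then show ?thesis by (simp add: binomial_gbinomial)
qed

lemma sum_card_Pow:
  assumes "finite A"
  shows "(\<Sum>S\<in>Pow A. g (card S)) = (\<Sum>k\<le>card A. of_nat (card A choose k) * (g k :: 'b::semiring_1))"
proof -
  have "(\<Sum>S\<in>Pow A. g (card S)) = (\<Sum>k\<le>card A. \<Sum>S | S \<in> Pow A \<and> card S = k. g (card S))"
    using assms by (intro sum.group[symmetric]) (auto simp: card_mono)
  also have "\<dots> = (\<Sum>k\<le>card A. of_nat (card A choose k) * g k)"
  proof (rule sum.cong[OF refl])
    fix k
    have "(\<Sum>S | S \<in> Pow A \<and> card S = k. g (card S)) = (\<Sum>S | S \<subseteq> A \<and> card S = k. g k)"
      by (rule sum.cong) auto
    then show "(\<Sum>S | S \<in> Pow A \<and> card S = k. g (card S)) = of_nat (card A choose k) * g k"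
      by (simp add: n_subsets[OF assms])
  qed
  finally show ?thesis .
qed


section \<open>Orbits of proper colorings\<close>

text \<open>The Hopf monoid enters the orbit counts only through the invariance of
  \<open>\<phi>_comp\<close> under \<open>G\<close>; what follows is combinatorics of this
  action.\<close>

locale coloring_action =
  fixes com :: "'a set \<Rightarrow> 'a set \<Rightarrow> 'h \<Rightarrow> ('h \<times> 'h) option"
    and \<phi> :: "'a set \<Rightarrow> 'h \<Rightarrow> nat"
    and N :: "'a set" and h :: 'h and G :: "('a \<Rightarrow> 'a) set"
  assumes finite_N: "finite N"
    and subgroup_G: "subgroup G (BijGroup N)"
    and \<phi>_comp_invariant: "g \<in> G \<Longrightarrow> C \<in> set_compositions N \<Longrightarrow>
      \<phi>_comp com \<phi> N (comp_act g C) h = \<phi>_comp com \<phi> N C h"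
begin

abbreviation colorings :: "('a \<Rightarrow> nat) set" where
  "colorings \<equiv> proper_colorings com \<phi> N h"

abbreviation P :: "('a \<Rightarrow> 'a) monoid" where
  "P \<equiv> perm_group N G"

section \<open>The group action on colorings\<close>

lemma group_P: "group P"
  using subgroup.subgroup_is_group[OF subgroup_G group_BijGroup] .

lemma G_Bij: "g \<in> G \<Longrightarrow> g \<in> Bij N"
  using subgroup.subset[OF subgroup_G] by (auto simp: BijGroup_def)

lemma finite_G: "finite G"
proof (rule finite_subset)
  show "G \<subseteq> N \<rightarrow>\<^sub>E N"
    using G_Bij Bij_imp_funcset Bij_imp_extensional unfolding PiE_def by blast
qed (simp add: finite_N finite_PiE)

lemma inv_G: "g \<in> G \<Longrightarrow> inv\<^bsub>BijGroup N\<^esub> g \<in> G"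
  using subgroup.m_inv_closed[OF subgroup_G] .

lemma inv_apply:
  assumes "g \<in> G" "v \<in> N"
  shows "(inv\<^bsub>BijGroup N\<^esub> g) v \<in> N" "g ((inv\<^bsub>BijGroup N\<^esub> g) v) = v"
    "(inv\<^bsub>BijGroup N\<^esub> g) (g v) = v" "g v \<in> N"
proof -
  have bij: "bij_betw g N N"
    using G_Bij[OF assms(1)] by (simp add: Bij_def)
  show gv: "g v \<in> N"
    using bij assms(2) bij_betwE by blast
  show "(inv\<^bsub>BijGroup N\<^esub> g) v \<in> N" "g ((inv\<^bsub>BijGroup N\<^esub> g) v) = v"
    "(inv\<^bsub>BijGroup N\<^esub> g) (g v) = v"
    using assms(2) gv bij
    by (simp_all add: inv_BijGroup[OF G_Bij[OF assms(1)]] Bij_inv_into_mem[OF G_Bij[OF assms(1)]]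
        bij_betw_inv_into_right bij_betw_inv_into_left)
qed

text \<open>A vertex has color i after the action iff its preimage under \<open>g\<close> had color
  i. The effect of \<open>g\<close> on the image, the composition and the monomial of a coloring is
  deduced from this.\<close>

lemma color_act_fibre:
  assumes "g \<in> G"
  shows "{v \<in> N. color_act N g f v = i} = g ` {v \<in> N. f v = i}"
proof (intro equalityI subsetI)
  fix v assume "v \<in> {v \<in> N. color_act N g f v = i}"
  then have "v \<in> N" "f ((inv\<^bsub>BijGroup N\<^esub> g) v) = i"
    by (auto simp: color_act_def compose_def)
  then show "v \<in> g ` {v \<in> N. f v = i}"
    using inv_apply[OF assms, of v] by (auto intro!: image_eqI[of _ _ "(inv\<^bsub>BijGroup N\<^esub> g) v"])
next
  fix v assume "v \<in> g ` {v \<in> N. f v = i}"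
  then obtain u where "u \<in> N" "f u = i" "v = g u" by auto
  then show "v \<in> {v \<in> N. color_act N g f v = i}"
    using inv_apply[OF assms, of u] by (simp add: color_act_def compose_def)
qed

lemma color_act_image:
  assumes "g \<in> G"
  shows "color_act N g f ` N = f ` N"
proof -
  have "f' ` N = {i. {v \<in> N. f' v = i} \<noteq> {}}" for f' :: "'a \<Rightarrow> nat"
    by auto
  then show ?thesis
    by (simp only: color_act_fibre[OF assms] image_is_empty)
qed

text \<open>The set of colors is unchanged, so the blocks keep their order while each is moved by
  \<open>g\<close>.\<close>

lemma color_comp_act:
  assumes "g \<in> G"
  shows "color_comp N (color_act N g f) = comp_act g (color_comp N f)"
  by (simp add: color_comp_def comp_act_def color_act_image[OF assms] color_act_fibre[OF assms])

lemma color_monomial_act: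
  assumes "g \<in> G"
  shows "color_monomial N (color_act N g f) = color_monomial N f"
proof (rule poly_mapping_eqI)
  fix i
  have "inj_on g {v \<in> N. f v = i}"
    using G_Bij[OF assms] by (auto simp: Bij_def bij_betw_def inj_on_def)
  then show "Poly_Mapping.lookup (color_monomial N (color_act N g f)) i =
      Poly_Mapping.lookup (color_monomial N f) i"
    by (simp add: lookup_color_monomial finite_N color_act_fibre[OF assms] card_image)
qed

lemma set_action_colorings: "set_action P colorings (color_act N)"
proof (rule set_action.intro[OF group_P], unfold_locales)
  fix g f assume "g \<in> carrier P" and f: "f \<in> colorings"
  then have g: "g \<in> G" by simp
  have ext: "color_act N g f \<in> extensional N"
    by (simp add: color_act_def compose_extensional)
  have "f ` N \<subseteq> {1..}"
    using f by (auto simp: proper_colorings_def)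
  then have "color_act N g f \<in> N \<rightarrow>\<^sub>E {1..}"
    using ext color_act_image[OF g, of f] by (auto simp: PiE_def)
  then show "color_act N g f \<in> colorings"
    using f by (simp add: proper_colorings_def color_comp_act[OF g]
        \<phi>_comp_invariant[OF g color_comp_set_compositions[OF finite_N]])
next
  fix f assume f: "f \<in> colorings"
  interpret B: group "BijGroup N" by (rule group_BijGroup)
  have "color_act N \<one>\<^bsub>BijGroup N\<^esub> f = compose N f \<one>\<^bsub>BijGroup N\<^esub>"
    by (simp add: color_act_def)
  also have "\<dots> = f"
  proof (rule extensionalityI)
    fix v assume "v \<in> N"
    then show "compose N f \<one>\<^bsub>BijGroup N\<^esub> v = f v"
      by (simp add: compose_def BijGroup_def)
  qed (use f in \<open>auto simp: proper_colorings_def PiE_def\<close>)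
  finally show "color_act N \<one>\<^bsub>P\<^esub> f = f" by simp
next
  fix g k f assume "g \<in> carrier P" "k \<in> carrier P"
  then have g: "g \<in> G" and k: "k \<in> G" by auto
  interpret B: group "BijGroup N" by (rule group_BijGroup)
  have carrier: "g \<in> carrier (BijGroup N)" "k \<in> carrier (BijGroup N)"
    using g k subgroup.subset[OF subgroup_G] by auto
  have mult: "a \<otimes>\<^bsub>BijGroup N\<^esub> b = compose N a b" if "a \<in> Bij N" "b \<in> Bij N" for a b
    using that by (simp add: BijGroup_def)
  \<comment> \<open>Inversion reverses products, which is why precomposition with the inverse is a
    left action.\<close>
  have inv: "inv\<^bsub>BijGroup N\<^esub> (g \<otimes>\<^bsub>BijGroup N\<^esub> k) =
      compose N (inv\<^bsub>BijGroup N\<^esub> k) (inv\<^bsub>BijGroup N\<^esub> g)"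
    unfolding B.inv_mult_group[OF carrier]
    using mult inv_G[OF g, THEN G_Bij] inv_G[OF k, THEN G_Bij] by blast
  have "color_act N (g \<otimes>\<^bsub>BijGroup N\<^esub> k) f = color_act N g (color_act N k f)"
    unfolding color_act_def inv
    using inv_apply(1)[OF g] by (auto simp: compose_def intro!: restrict_ext)
  then show "color_act N (g \<otimes>\<^bsub>P\<^esub> k) f = color_act N g (color_act N k f)"
    by simp
qed

sublocale set_action P colorings "color_act N"
  by (rule set_action_colorings)

text \<open>Common form of the two counts: \<open>Q\<close> either prescribes the monomial or bounds
  the colors, and is invariant under \<open>G\<close> in both uses.\<close>

definition orbit_count :: "(('a \<Rightarrow> nat) \<Rightarrow> bool) \<Rightarrow> nat" where
  "orbit_count Q = card (orbits P {f \<in> colorings. Q f} (color_act N))"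

lemma set_action_monomial:
  "set_action P {f \<in> colorings. color_monomial N f = m} (color_act N)"
  by (rule set_action_fibre) (simp add: color_monomial_act)

lemma set_action_image: "set_action P {f \<in> colorings. Q (f ` N)} (color_act N)"
  by (rule set_action_fibre) (simp add: color_act_image)

lemma finite_colorings:
  assumes "finite S"
  shows "finite {f \<in> colorings. f ` N \<subseteq> S}"
proof (rule finite_subset)
  show "{f \<in> colorings. f ` N \<subseteq> S} \<subseteq> N \<rightarrow>\<^sub>E S"
    by (auto simp: proper_colorings_def PiE_def)
qed (simp add: finite_N assms finite_PiE)

text \<open>The support of the monomial is the set of colors used, which leaves finitely many
  colorings.\<close>

lemma finite_colorings_monomial: "finite {f \<in> colorings. color_monomial N f = m}"
  by (rule finite_subset[OF _ finite_colorings[of "Poly_Mapping.keys m"]])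
    (auto simp: keys_color_monomial[OF finite_N, symmetric])

text \<open>The monomial is constant on orbits, so the representative chosen in
  \<open>orbit_monomial\<close> does not matter and the orbits with monomial \<open>m\<close> are
  the orbits on the fibre over \<open>m\<close>.\<close>

lemma orbital_chromatic_qsym_eq:
  "orbital_chromatic_qsym com \<phi> N h G m = of_nat (orbit_count (\<lambda>f. color_monomial N f = m))"
proof -
  have mon: "orbit_monomial N (orbit P (color_act N) f) = color_monomial N f" if "f \<in> colorings" for f
  proof -
    have "(SOME f'. f' \<in> orbit P (color_act N) f) \<in> orbit P (color_act N) f"
      by (rule someI[where P = "\<lambda>f'. f' \<in> orbit P (color_act N) f", OF orbit_refl[OF that]])
    then show ?thesis
      unfolding orbit_monomial_def by (auto simp: orbit_def color_monomial_act)
  qed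
  have "{O' \<in> orbits P colorings (color_act N). orbit_monomial N O' = m} =
      orbits P {f \<in> colorings. color_monomial N f = m} (color_act N)"
    unfolding orbits_def Setcompr_eq_image using mon by auto
  then show ?thesis
    by (simp add: orbital_chromatic_qsym_def monomial_sum_def orbit_count_def)
qed

section \<open>Averaging over the group\<close>

lemma orbit_count_burnside:
  assumes "set_action P {f \<in> colorings. Q f} (color_act N)" "finite {f \<in> colorings. Q f}"
  shows "(of_nat (orbit_count Q) :: rat) =
    1 / of_nat (card G) * (\<Sum>g\<in>G. of_nat (card (invariants {f \<in> colorings. Q f} (color_act N) g)))"
proof -
  have "orbit_count Q * card G = (\<Sum>g\<in>G. card (invariants {f \<in> colorings. Q f} (color_act N) g))"
    using set_action.burnside[OF assms(1) _ assms(2)] finite_G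
    by (simp add: orbit_count_def Coset.order_def)
  then have "(of_nat (orbit_count Q) :: rat) * of_nat (card G) =
      (\<Sum>g\<in>G. of_nat (card (invariants {f \<in> colorings. Q f} (color_act N) g)))"
    by (metis of_nat_mult of_nat_sum)
  moreover have "card G \<noteq> 0"
    using finite_G subgroup.one_closed[OF subgroup_G] by auto
  ultimately show ?thesis by (simp add: field_simps)
qed

text \<open>Burnside's lemma is applied one coefficient at a time, on the finite fibre over
  \<open>m\<close>; its fixed points are the fixed colorings with monomial \<open>m\<close>.\<close>

lemma orbital_chromatic_qsym_burnside:
  "orbital_chromatic_qsym com \<phi> N h G m =
   1 / of_nat (card G) * (\<Sum>g\<in>G. chromatic_qsym com \<phi> N h g m)"
proof -
  have "invariants {f \<in> colorings. color_monomial N f = m} (color_act N) g =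
      {f \<in> invariants colorings (color_act N) g. color_monomial N f = m}" for g
    by (auto simp: invariants_def)
  then show ?thesis
    using orbit_count_burnside[OF set_action_monomial finite_colorings_monomial]
    by (simp add: orbital_chromatic_qsym_eq chromatic_qsym_def monomial_sum_def)
qed

lemma orbital_chromatic_count_burnside:
  "(of_nat (orbital_chromatic_count com \<phi> N h G n) :: rat) =
   1 / of_nat (card G) * (\<Sum>g\<in>G. of_nat (chromatic_count com \<phi> N h n g))"
  using orbit_count_burnside[OF set_action_image finite_colorings, of "{1..n}"]
  by (simp add: orbit_count_def orbital_chromatic_count_def chromatic_count_def)

section \<open>Coefficients in the monomial basis\<close>

definition proper_compositions :: "'a set list set" where
  "proper_compositions = {C \<in> set_compositions N. \<phi>_comp com \<phi> N C h = 1}"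

lemma bij_betw_color_comp_proper:
  assumes "finite S" "0 \<notin> S"
  shows "bij_betw (color_comp N) {f \<in> colorings. f ` N = S}
    {C \<in> proper_compositions. length C = card S}"
proof -
  let ?A = "{f \<in> extensional N. f ` N = S}"
    and ?B = "{C \<in> set_compositions N. length C = card S}"
  have "bij_betw (color_comp N) ?A ?B"
    using finite_N assms(1) by (rule bij_betw_color_comp)
  then have "bij_betw (color_comp N) {f \<in> ?A. \<phi>_comp com \<phi> N (color_comp N f) h = 1}
      {C \<in> ?B. \<phi>_comp com \<phi> N C h = 1}"
    by (rule bij_betw_Collect) simp
  \<comment> \<open>As 0 is not in \<open>S\<close>, every coloring with image \<open>S\<close> has
    positive colors, as \<open>proper_colorings\<close> demands.\<close>
  moreover have "{f \<in> ?A. \<phi>_comp com \<phi> N (color_comp N f) h = 1} = {f \<in> colorings. f ` N = S}"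
    using assms(2) by (auto simp: proper_colorings_def PiE_def Suc_le_eq intro!: gr0I)
  moreover have "{C \<in> ?B. \<phi>_comp com \<phi> N C h = 1} = {C \<in> proper_compositions. length C = card S}"
    by (auto simp: proper_compositions_def)
  ultimately show ?thesis by simp
qed

text \<open>A coloring has monomial \<open>m\<close> iff its image is the support of
  \<open>m\<close> and its composition has type \<open>exponents m\<close>. On these colorings
  \<open>color_comp\<close> is an equivariant bijection onto the compositions of that type.\<close>

lemma orbit_count_monomial:
  assumes "0 \<notin> Poly_Mapping.keys m"
  shows "orbit_count (\<lambda>f. color_monomial N f = m) =
    card (orbits P (comps_of_type com \<phi> N h (exponents m)) comp_act)"
proof -
  let ?S = "Poly_Mapping.keys m"
  let ?A = "{f \<in> colorings. f ` N = ?S}" and ?B = "{C \<in> proper_compositions. length C = card ?S}"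
  have "bij_betw (color_comp N) {f \<in> ?A. comp_type (color_comp N f) = exponents m}
      {C \<in> ?B. comp_type C = exponents m}"
    using bij_betw_color_comp_proper[OF finite_keys assms] by (rule bij_betw_Collect) simp
  moreover have "{f \<in> ?A. comp_type (color_comp N f) = exponents m} =
      {f \<in> colorings. color_monomial N f = m}"
    using exponents_inject keys_color_monomial[OF finite_N] comp_type_color_comp[OF finite_N]
    by auto
  \<comment> \<open>The type already fixes the number of blocks, so the length condition in
    \<open>?B\<close> is absorbed.\<close>
  moreover have "length C = card ?S" if "comp_type C = exponents m" for C :: "'a set list"
    using arg_cong[OF that, of length] by (simp add: comp_type_def exponents_def)
  then have "{C \<in> ?B. comp_type C = exponents m} = comps_of_type com \<phi> N h (exponents m)"
    by (auto simp: proper_compositions_def comps_of_type_def)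
  ultimately have "bij_betw (color_comp N) {f \<in> colorings. color_monomial N f = m}
      (comps_of_type com \<phi> N h (exponents m))"
    by simp
  from set_action.card_orbits_bij_betw[OF set_action_monomial this] show ?thesis
    by (simp add: orbit_count_def color_comp_act)
qed

lemma M_coeff_orbital_chromatic_qsym:
  assumes "0 \<notin> set \<alpha>"
  shows "M_coeff (orbital_chromatic_qsym com \<phi> N h G) \<alpha> =
    of_nat (card (orbits P (comps_of_type com \<phi> N h \<alpha>) comp_act))"
  using _ _ _ assms
proof (rule M_coeff_eqI)
  fix m :: monomial
  {
    assume m: "0 \<in> Poly_Mapping.keys m"
    \<comment> \<open>Colors are positive, so no proper coloring has a monomial involving index
      0.\<close>
    have "{f \<in> colorings. color_monomial N f = m} = {}"
    proof (intro equals0I, clarify)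
      fix f assume "f \<in> colorings" "m = color_monomial N f"
      then have "0 \<in> f ` N" "f ` N \<subseteq> {1..}"
        using m by (auto simp: keys_color_monomial[OF finite_N] proper_colorings_def)
      then show False by auto
    qed
    then show "orbital_chromatic_qsym com \<phi> N h G m = 0"
      by (simp add: orbital_chromatic_qsym_eq orbit_count_def orbits_def Setcompr_eq_image
          del: Collect_empty_eq)
  }
  show "0 \<notin> Poly_Mapping.keys m \<Longrightarrow> orbital_chromatic_qsym com \<phi> N h G m =
      of_nat (card (orbits P (comps_of_type com \<phi> N h (exponents m)) comp_act))"
    by (simp add: orbital_chromatic_qsym_eq orbit_count_monomial)
next
  \<comment> \<open>Types of set compositions of \<open>N\<close> are compositions of
    \<open>card N\<close>, so only finitely many \<alpha> contribute.\<close>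
  have "\<alpha> \<in> int_compositions (card N)"
    if "card (orbits P (comps_of_type com \<phi> N h \<alpha>) comp_act) \<noteq> 0" for \<alpha>
  proof -
    have "comps_of_type com \<phi> N h \<alpha> \<noteq> {}"
      using that by (auto simp: orbits_def)
    then show ?thesis
      using comp_type_set_composition[OF finite_N] by (auto simp: comps_of_type_def)
  qed
  then show "finite {\<alpha>. (of_nat (card (orbits P (comps_of_type com \<phi> N h \<alpha>) comp_act)) :: rat) \<noteq> 0}"
    by (intro finite_subset[OF _ finite_int_compositions[of "card N"]]) auto
qed

section \<open>Principal specialization and orbits with bounded colors\<close>

lemma specialize_orbital_chromatic_qsym:
  "specialize (orbital_chromatic_qsym com \<phi> N h G) n =
   of_nat (orbital_chromatic_count com \<phi> N h G n)"
proof -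
  let ?E = "{f \<in> colorings. f ` N \<subseteq> {1..n}}"
  let ?F = "orbital_chromatic_qsym com \<phi> N h G"
  have fibre: "{f \<in> ?E. color_monomial N f = m} = {f \<in> colorings. color_monomial N f = m}"
    if "Poly_Mapping.keys m \<subseteq> {1..n}" for m
    using that by (auto simp: keys_color_monomial[OF finite_N])
  have orbits_image: "orbits P X (color_act N) = orbit P (color_act N) ` X" for X
    unfolding orbits_def by (rule Setcompr_eq_image)
  \<comment> \<open>A finite nonempty set has a positive number of orbits. Finiteness matters
    because \<open>card\<close> of an infinite set is 0.\<close>
  have nonzero: "?F m \<noteq> 0 \<longleftrightarrow> {f \<in> colorings. color_monomial N f = m} \<noteq> {}" for m
    using finite_colorings_monomial[of m]
    by (simp add: orbital_chromatic_qsym_eq orbit_count_def orbits_image del: Collect_empty_eq)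
  \<comment> \<open>The monomials summed by \<open>specialize\<close> are those of proper colorings
    with colors up to \<open>n\<close>, hence finitely many.\<close>
  have support: "{m. Poly_Mapping.keys m \<subseteq> {1..n} \<and> ?F m \<noteq> 0} = color_monomial N ` ?E"
  proof (intro equalityI subsetI)
    fix m assume "m \<in> {m. Poly_Mapping.keys m \<subseteq> {1..n} \<and> ?F m \<noteq> 0}"
    then have keys: "Poly_Mapping.keys m \<subseteq> {1..n}" and "?F m \<noteq> 0" by blast+
    then obtain f where f: "f \<in> colorings" "color_monomial N f = m"
      unfolding nonzero by blast
    then show "m \<in> color_monomial N ` ?E"
      using keys keys_color_monomial[OF finite_N, of f] by blast
  next
    fix m assume "m \<in> color_monomial N ` ?E"
    then obtain f where f: "f \<in> colorings" "f ` N \<subseteq> {1..n}" "color_monomial N f = m" by blast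
    then have "?F m \<noteq> 0"
      unfolding nonzero by blast
    then show "m \<in> {m. Poly_Mapping.keys m \<subseteq> {1..n} \<and> ?F m \<noteq> 0}"
      using f keys_color_monomial[OF finite_N, of f] by blast
  qed
  have fin: "finite ?E"
    by (simp add: finite_colorings)
  \<comment> \<open>The monomial is an invariant of orbits, so the orbits counted here split
    according to it.\<close>
  have count: "orbital_chromatic_count com \<phi> N h G n =
      (\<Sum>m\<in>color_monomial N ` ?E. card (orbits P {f \<in> ?E. color_monomial N f = m} (color_act N)))"
    unfolding orbital_chromatic_count_def
  proof (rule set_action.card_orbits_fibres[OF set_action_image])
    show "color_monomial N (color_act N g f) = color_monomial N f" if "g \<in> carrier P" for g f
      using that by (simp add: color_monomial_act)
    show "finite (color_monomial N ` ?E)"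
      using fin by (rule finite_imageI)
  qed (fact fin, rule subset_refl)
  have "(of_nat (orbital_chromatic_count com \<phi> N h G n) :: rat) =
      (\<Sum>m\<in>color_monomial N ` ?E. ?F m)"
    unfolding count of_nat_sum
  proof (rule sum.cong[OF refl])
    fix m assume "m \<in> color_monomial N ` ?E"
    then have "Poly_Mapping.keys m \<subseteq> {1..n}"
      by (auto simp: keys_color_monomial[OF finite_N])
    then show "of_nat (card (orbits P {f \<in> ?E. color_monomial N f = m} (color_act N))) = ?F m"
      by (simp only: fibre orbital_chromatic_qsym_eq orbit_count_def)
  qed
  then show ?thesis
    unfolding specialize_def support by (rule sym)
qed

section \<open>Polynomial dependence on the number of colors\<close>

definition length_orbit_count :: "nat \<Rightarrow> nat" where
  "length_orbit_count k = card (orbits P {C \<in> proper_compositions. length C = k} comp_act)"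

text \<open>Blocks are nonempty, so a composition of \<open>N\<close> has at most
  \<open>card N\<close> of them.\<close>

lemma length_orbit_count_eq_0:
  assumes "k > card N"
  shows "length_orbit_count k = 0"
proof -
  have "length C \<le> card N" if "C \<in> set_compositions N" for C
  proof -
    have "comp_type C \<in> int_compositions (card N)"
      using that by (rule comp_type_set_composition[OF finite_N])
    then show ?thesis
      using length_le_sum_list[of "comp_type C"] by (simp add: int_compositions_def comp_type_def)
  qed
  then have "length C \<noteq> k" if "C \<in> proper_compositions" for C
    using that assms by (auto simp: proper_compositions_def not_less[symmetric])
  then have empty: "{C \<in> proper_compositions. length C = k} = {}"
    by blast
  show ?thesis
    unfolding length_orbit_count_def orbits_def empty by simp
qed

text \<open>Orbits are split by the set of colors used. For a set of k colors,
  \<open>color_comp\<close> identifies them with orbits of proper compositions with k blocks, and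
  there are \<open>n choose k\<close> such sets.\<close>

lemma orbital_chromatic_count_eq:
  "orbital_chromatic_count com \<phi> N h G n = (\<Sum>k\<le>card N. (n choose k) * length_orbit_count k)"
proof -
  let ?E = "{f \<in> colorings. f ` N \<subseteq> {1..n}}"
  have "orbital_chromatic_count com \<phi> N h G n =
      (\<Sum>S\<in>Pow {1..n}. card (orbits P {f \<in> ?E. f ` N = S} (color_act N)))"
    unfolding orbital_chromatic_count_def
  proof (rule set_action.card_orbits_fibres[OF set_action_image])
    show "color_act N g f ` N = f ` N" if "g \<in> carrier P" for g f
      using that by (simp add: color_act_image)
    show "finite ?E"
      by (simp add: finite_colorings)
  qed auto
  also have "\<dots> = (\<Sum>S\<in>Pow {1..n}. length_orbit_count (card S))"
  proof (rule sum.cong[OF refl])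
    fix S assume "S \<in> Pow {1..n}"
    then have S: "S \<subseteq> {1..n}" "finite S" "0 \<notin> S"
      using finite_subset by auto
    have "{f \<in> ?E. f ` N = S} = {f \<in> colorings. f ` N = S}"
      using S(1) by blast
    moreover have "length_orbit_count (card S) =
        card (orbits P {f \<in> colorings. f ` N = S} (color_act N))"
      unfolding length_orbit_count_def
      by (rule set_action.card_orbits_bij_betw[OF set_action_image
            bij_betw_color_comp_proper[OF S(2,3)]])
        (simp add: color_comp_act)
    ultimately show "card (orbits P {f \<in> ?E. f ` N = S} (color_act N)) =
        length_orbit_count (card S)"
      by simp
  qed
  also have "\<dots> = (\<Sum>k\<le>n. (n choose k) * length_orbit_count k)"
    unfolding sum_card_Pow[OF finite_atLeastAtMost] by simp
  \<comment> \<open>The upper bound is made independent of \<open>n\<close>: terms with k >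
    \<open>n\<close> vanish by the binomial coefficient, those with k > \<open>card N\<close> by the
    bound on the number of blocks.\<close>
  also have "\<dots> = (\<Sum>k\<le>max n (card N). (n choose k) * length_orbit_count k)"
    by (intro sum.mono_neutral_left) (auto simp: binomial_eq_0)
  also have "\<dots> = (\<Sum>k\<le>card N. (n choose k) * length_orbit_count k)"
    by (intro sum.mono_neutral_right) (auto simp: length_orbit_count_eq_0)
  finally show ?thesis .
qed

text \<open>The binomial sum for the orbit count is a polynomial in \<open>n\<close>, given
  explicitly by \<open>p\<close>; it has the values required by \<open>ps\<close>, so
  \<open>ps\<close> denotes it.\<close>

lemma poly_ps_orbital_chromatic_qsym:
  "poly (ps (orbital_chromatic_qsym com \<phi> N h G)) (of_nat n) =
   of_nat (orbital_chromatic_count com \<phi> N h G n)"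
proof -
  define p where "p = (\<Sum>k\<le>card N. smult (of_nat (length_orbit_count k)) (binomial_poly k))"
  have p: "poly p (of_nat n) = of_nat (orbital_chromatic_count com \<phi> N h G n)" for n
    by (simp add: p_def poly_sum poly_binomial_poly orbital_chromatic_count_eq mult.commute)
  have "ps (orbital_chromatic_qsym com \<phi> N h G) = p"
    by (rule ps_eqI) (simp add: p specialize_orbital_chromatic_qsym)
  with p show ?thesis by simp
qed

end

text \<open>An automorphism is a bijection from \<open>N\<close> to itself that fixes
  \<open>h\<close>, so naturality of \<open>\<phi>_comp\<close> turns into invariance.\<close>

lemma (in linearized_combinatorial_hopf_monoid) coloring_action:
  assumes "finite N" "h \<in> H N" "subgroup G (BijGroup N)" "G \<subseteq> aut Hmap N h"
  shows "coloring_action com \<phi> N h G"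
proof (rule coloring_action.intro)
  fix g C assume g: "g \<in> G" and C: "C \<in> set_compositions N"
  have "g \<in> bijections N N" "Hmap N g h = h"
    using g assms(4) by (auto simp: aut_def stabilizer_def BijGroup_def Bij_def bijections_def)
  then show "\<phi>_comp com \<phi> N (comp_act g C) h = \<phi>_comp com \<phi> N C h"
    using \<phi>_comp_natural[of N g N h C] assms C by (simp add: comp_act_def)
qed (fact assms)+

theorem theorem4:
  fixes H :: "'a::infinite set \<Rightarrow> 'h set"
    and Hmap :: "'a set \<Rightarrow> ('a \<Rightarrow> 'a) \<Rightarrow> 'h \<Rightarrow> 'h"
    and mul :: "'a set \<Rightarrow> 'a set \<Rightarrow> 'h \<Rightarrow> 'h \<Rightarrow> 'h"
    and com :: "'a set \<Rightarrow> 'a set \<Rightarrow> 'h \<Rightarrow> ('h \<times> 'h) option"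
    and \<phi> :: "'a set \<Rightarrow> 'h \<Rightarrow> nat"
    and N :: "'a set" and h :: 'h and G :: "('a \<Rightarrow> 'a) set"
  assumes "linearized_combinatorial_hopf_monoid H Hmap TYPE('k::field) mul com \<phi>"
    and "finite N" and "h \<in> H N"
    and "subgroup G (BijGroup N)" and "G \<subseteq> aut Hmap N h"
  shows "orbital_chromatic_qsym com \<phi> N h G =
           (\<lambda>m. (1 / of_nat (card G)) * (\<Sum>g\<in>G. chromatic_qsym com \<phi> N h g m)) \<and>
         (\<forall>\<alpha>\<in>int_compositions (card N).
           M_coeff (orbital_chromatic_qsym com \<phi> N h G) \<alpha> =
           of_nat (card (orbits (perm_group N G) (comps_of_type com \<phi> N h \<alpha>) comp_act))) \<and>
         (\<forall>n. of_nat (orbital_chromatic_count com \<phi> N h G n) =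
                poly (ps (orbital_chromatic_qsym com \<phi> N h G)) (of_nat n) \<and>
              poly (ps (orbital_chromatic_qsym com \<phi> N h G)) (of_nat n) =
                (1 / of_nat (card G)) * (\<Sum>g\<in>G. of_nat (chromatic_count com \<phi> N h n g)))"
proof -
  interpret coloring_action com \<phi> N h G
    using linearized_combinatorial_hopf_monoid.coloring_action[OF assms] .
  show ?thesis
  proof (intro conjI ballI allI)
    show "orbital_chromatic_qsym com \<phi> N h G =
        (\<lambda>m. (1 / of_nat (card G)) * (\<Sum>g\<in>G. chromatic_qsym com \<phi> N h g m))"
      by (rule ext) (rule orbital_chromatic_qsym_burnside)
  next
    fix \<alpha> assume "\<alpha> \<in> int_compositions (card N)"
    then have "0 \<notin> set \<alpha>" by (simp add: int_compositions_def)
    then show "M_coeff (orbital_chromatic_qsym com \<phi> N h G) \<alpha> =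
        of_nat (card (orbits P (comps_of_type com \<phi> N h \<alpha>) comp_act))"
      by (rule M_coeff_orbital_chromatic_qsym)
  \<comment> \<open>Both equalities of the third claim pass through the orbit count: it is the value
    of the specialization, and Burnside's lemma evaluates it.\<close>
  qed (simp_all only: poly_ps_orbital_chromatic_qsym orbital_chromatic_count_burnside)
qed

end
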